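(* Let $d\ge 2$ and let $C:[0,1]^d\to[0,1]$ be a copula with order transform $C_T$. Then Kendall's tau satisfies $$\kappa[C]\le\kappa[C_T].$$ In particular: (1) If $C_T$ minimizes Kendall's tau, then $C$ minimizes Kendall's tau as well. (2) If $C$ is symmetric and minimizes Kendall's tau, then $C_T$ minimizes Kendall's tau as well.
   Context: Notation: $\overline{\mathbb R}=[-\infty,\infty]$; vectors are ordered coordinatewise. For a copula $C$ on $[0,1]^d$, $Q^C$ is the unique Borel probability measure on $[0,1]^d$ with $Q^C[[\mathbf 0,\mathbf u]]=C(\mathbf u)$ for all $\mathbf u\in[0,1]^d$. Kendall's tau: for $d$-dimensional copulas $C,D$ put $[C,D]:=\int_{[0,1]^d}C(\mathbf u)\,dQ^D(\mathbf u)$ and $\kappa[C]:=\dfrac{2^d[C,C]-1}{2^{d-1}-1}$. One has $-\frac{1}{2^{d-1}-1}\le\kappa[C]\le 1$ for every copula $C$ and both bounds are attained; "$C$ minimizes Kendall's tau" means that $\kappa[C]$ is the minimum of $\kappa$ over all $d$-dimensional copulas. A copula $C$ is symmetric if $C(u_{\sigma(1)},\dots,u_{\sigma(d)})=C(u_1,\dots,u_d)$ for all $\mathbf u\in[0,1]^d$ and every permutation $\sigma$ of $\{1,\dots,d\}$. Order transform: $T:\overline{\mathbb R}^d\to\overline{\mathbb R}^d$ is $(T(\mathbf x))_k:=\min_{J\subseteq\{1,\dots,d\},|J|=k}\max_{l\in J}x_l$, i.e. $T(\mathbf x)$ is the nondecreasing rearrangement of $\mathbf x$. Let $H^C:\overline{\mathbb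 R}^d\to[0,1]$ be the distribution function extending $C$, i.e. $H^C(\mathbf x)=C(h(x_1),\dots,h(x_d))$ with $h(x)=\max\{0,\min\{x,1\}\}$, and let $Q^{H^C}$ be the corresponding probability measure. Let $H^C_T$ be the distribution function of the image measure $(Q^{H^C})_T=Q^{H^C}\circ T^{-1}$. Its univariate marginal distribution functions $(H^C_T)_1,\dots,(H^C_T)_d$ are continuous, so there is a unique copula $C_T$, called the order transform of $C$, with $H^C_T(\mathbf x)=C_T\big((H^C_T)_1(x_1),\dots,(H^C_T)_d(x_d)\big)$ for all $\mathbf x\in\overline{\mathbb R}^d$. *)

theory Defs
  imports "HOL-Probability.Probability" "HOL-Combinatorics.Permutations"
begin

text \<open>
  Vectors of length \<open>d\<close> are extensional functions on \<open>{1..d}\<close>, so that functions on the cube and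
  Borel measures on the cube or on the extended real space are uniquely determined objects. All
  spaces involved are second countable, so that the product sigma-algebra is the Borel one.
\<close>

definition cube :: "nat \<Rightarrow> (nat \<Rightarrow> real) set" where
  "cube d = ({1..d} \<rightarrow>\<^sub>E {0..1})"

definition ext_space :: "nat \<Rightarrow> (nat \<Rightarrow> ereal) set" where
  "ext_space d = ({1..d} \<rightarrow>\<^sub>E UNIV)"

definition cube_borel :: "nat \<Rightarrow> (nat \<Rightarrow> real) measure" where
  "cube_borel d = PiM {1..d} (\<lambda>_. restrict_space borel {0..1})"

definition ext_borel :: "nat \<Rightarrow> (nat \<Rightarrow> ereal) measure" where
  "ext_borel d = PiM {1..d} (\<lambda>_. borel)"

text \<open>The alternating sum is the \<open>C\<close>-volume of the box with lower corner \<open>u\<close> and upper corner \<open>v\<close>.\<close>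

definition copula :: "nat \<Rightarrow> ((nat \<Rightarrow> real) \<Rightarrow> real) \<Rightarrow> bool" where
  "copula d C \<longleftrightarrow>
     C \<in> cube d \<rightarrow>\<^sub>E {0..1} \<and>
     (\<forall>u\<in>cube d. \<forall>v\<in>cube d. (\<forall>i\<in>{1..d}. u i \<le> v i) \<longrightarrow>
        0 \<le> (\<Sum>K\<in>Pow {1..d}. (-1) ^ (d - card K) * C (\<lambda>i\<in>{1..d}. if i \<in> K then v i else u i))) \<and>
     (\<forall>u\<in>cube d. (\<exists>i\<in>{1..d}. u i = 0) \<longrightarrow> C u = 0) \<and>
     (\<forall>u\<in>cube d. \<forall>i\<in>{1..d}. (\<forall>j\<in>{1..d} - {i}. u j = 1) \<longrightarrow> C u = u i)"

definition symmetric_copula :: "nat \<Rightarrow> ((nat \<Rightarrow> real) \<Rightarrow> real) \<Rightarrow> bool" where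
  "symmetric_copula d C \<longleftrightarrow>
     copula d C \<and> (\<forall>u\<in>cube d. \<forall>\<sigma>. \<sigma> permutes {1..d} \<longrightarrow> C (\<lambda>i\<in>{1..d}. u (\<sigma> i)) = C u)"

definition copula_measure :: "nat \<Rightarrow> ((nat \<Rightarrow> real) \<Rightarrow> real) \<Rightarrow> (nat \<Rightarrow> real) measure" where
  "copula_measure d C =
     (THE Q. prob_space Q \<and> sets Q = sets (cube_borel d) \<and>
        (\<forall>u\<in>cube d. measure Q (PiE {1..d} (\<lambda>i. {0..u i})) = C u))"

definition copula_bracket ::
    "nat \<Rightarrow> ((nat \<Rightarrow> real) \<Rightarrow> real) \<Rightarrow> ((nat \<Rightarrow> real) \<Rightarrow> real) \<Rightarrow> real" where
  "copula_bracket d C D = (\<integral>u. C u \<partial>copula_measure d D)"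

definition kendall_tau :: "nat \<Rightarrow> ((nat \<Rightarrow> real) \<Rightarrow> real) \<Rightarrow> real" where
  "kendall_tau d C = (2 ^ d * copula_bracket d C C - 1) / (2 ^ (d - 1) - 1)"

definition minimizes_kendall_tau :: "nat \<Rightarrow> ((nat \<Rightarrow> real) \<Rightarrow> real) \<Rightarrow> bool" where
  "minimizes_kendall_tau d C \<longleftrightarrow>
     copula d C \<and> (\<forall>D. copula d D \<longrightarrow> kendall_tau d C \<le> kendall_tau d D)"

definition order_map :: "nat \<Rightarrow> (nat \<Rightarrow> ereal) \<Rightarrow> nat \<Rightarrow> ereal" where
  "order_map d x = (\<lambda>k\<in>{1..d}. Min ((\<lambda>J. Max (x ` J)) ` {J. J \<subseteq> {1..d} \<and> card J = k}))"

definition extend_df :: "nat \<Rightarrow> ((nat \<Rightarrow> real) \<Rightarrow> real) \<Rightarrow> (nat \<Rightarrow> ereal) \<Rightarrow> real" where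
  "extend_df d C x = C (\<lambda>i\<in>{1..d}. real_of_ereal (max 0 (min (x i) 1)))"

definition df_measure :: "nat \<Rightarrow> ((nat \<Rightarrow> ereal) \<Rightarrow> real) \<Rightarrow> (nat \<Rightarrow> ereal) measure" where
  "df_measure d H =
     (THE Q. prob_space Q \<and> sets Q = sets (ext_borel d) \<and>
        (\<forall>x\<in>ext_space d. measure Q (PiE {1..d} (\<lambda>i. {..x i})) = H x))"

definition df_of :: "nat \<Rightarrow> (nat \<Rightarrow> ereal) measure \<Rightarrow> (nat \<Rightarrow> ereal) \<Rightarrow> real" where
  "df_of d Q x = measure Q (PiE {1..d} (\<lambda>i. {..x i}))"

definition marginal_df :: "nat \<Rightarrow> ((nat \<Rightarrow> ereal) \<Rightarrow> real) \<Rightarrow> nat \<Rightarrow> ereal \<Rightarrow> real" where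
  "marginal_df d H i t = H (\<lambda>j\<in>{1..d}. if j = i then t else \<infinity>)"

definition order_df :: "nat \<Rightarrow> ((nat \<Rightarrow> real) \<Rightarrow> real) \<Rightarrow> (nat \<Rightarrow> ereal) \<Rightarrow> real" where
  "order_df d C = df_of d (distr (df_measure d (extend_df d C)) (ext_borel d) (order_map d))"

definition order_transform ::
    "nat \<Rightarrow> ((nat \<Rightarrow> real) \<Rightarrow> real) \<Rightarrow> (nat \<Rightarrow> real) \<Rightarrow> real" where
  "order_transform d C =
     (THE D. copula d D \<and>
        (\<forall>x\<in>ext_space d.
           order_df d C x = D (\<lambda>i\<in>{1..d}. marginal_df d (order_df d C) i (x i))))"

end

theory Submission
  imports Defs
begin

text \<open>
  Let \<open>U\<close>, \<open>U'\<close> be independent with law \<open>Q\<^sup>C\<close>. Then \<open>[C, C]\<close> is the probability of \<open>U' \<le> U\<close>, and since the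
  marginal distribution functions of \<open>T U\<close> are continuous, \<open>[C\<^sub>T, C\<^sub>T]\<close> is the probability of
  \<open>T U' \<le> T U\<close>. The order transform \<open>T\<close> is monotone, which gives the inequality. Conversely, \<open>T U' \<le> T U\<close>
  forces \<open>U'\<close> to lie below some permutation of \<open>U\<close>, so \<open>[C\<^sub>T, C\<^sub>T] \<le> d! [C, C]\<close> for symmetric \<open>C\<close>. The minimum
  of \<open>[C, C]\<close> is \<open>0\<close>, attained by the law of \<open>(W, 1 - W, W, \<dots>, W)\<close> with \<open>W\<close> uniform.

  The measure \<open>Q\<^sup>C\<close> is obtained as the law, under Lebesgue measure on \<open>[0, 1)\<close>, of the limit of nested
  boxes: the cube is bisected repeatedly, and subintervals of \<open>[0, 1)\<close> of length the \<open>C\<close>-volume of each box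
  are nested accordingly.
\<close>

subsection \<open>Probability measures on the cube and copulas\<close>

text \<open>\<open>copula_measure\<close>, \<open>df_measure\<close> and
  \<open>order_transform\<close> are definite descriptions, so nothing can be said about them before
  existence and uniqueness are settled. The existence of \<open>Q\<close> is the costly case:
  \<open>copula\<close> mentions only volumes of boxes, and the other two objects are then images of
  \<open>Q\<close>. The obstacle in the nested-box construction is that the limit point may lie on a
  face of its cells. Volumes therefore only sandwich its law: cells entirely below \<open>u\<close>
  bound it from one side, cells whose lower corner is below \<open>u\<close> from the other. The
  uniform marginals close the gap, since they leave no atoms on the faces. For the order transform
  the obstacle is that marginal distribution functions may be flat on intervals, hence not
  injective. Working with the largest quantile of each level reduces this to null sets. The crude
  factor \<open>d!\<close> does no harm because the minimum of the bracket is exactly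
  \<open>0\<close>, which corresponds to the lower bound \<open>-1 / (2 ^ (d - 1) - 1)\<close> of
  Kendall's tau.\<close>

lemma sets_PiM_lower_boxes:
  fixes S :: "'a::{linorder_topology, second_countable_topology} set"
  assumes "finite I" and top: "t \<in> S" "\<And>s. s \<in> S \<Longrightarrow> s \<le> t" and S: "S \<in> sets borel"
  shows "sets (PiM I (\<lambda>_. restrict_space borel S)) =
    sigma_sets (I \<rightarrow>\<^sub>E S) (range (\<lambda>x. PiE I (\<lambda>i. S \<inter> {..x i})))"
proof
  let ?G = "range (\<lambda>x. PiE I (\<lambda>i. S \<inter> {..x i}))"
  let ?N = "sigma (I \<rightarrow>\<^sub>E S) ?G"
  have G: "?G \<subseteq> Pow (I \<rightarrow>\<^sub>E S)" by (auto simp: PiE_iff)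
  have [simp]: "sets ?N = sigma_sets (I \<rightarrow>\<^sub>E S) ?G" "space ?N = (I \<rightarrow>\<^sub>E S)"
    using G by (auto intro: sets_measure_of space_measure_of)
  have "(\<lambda>x. x i) \<in> measurable ?N (restrict_space borel S)" if i: "i \<in> I" for i
  proof (rule measurable_restrict_space2)
    show "(\<lambda>x. x i) \<in> space ?N \<rightarrow> S" using i by auto
    show "(\<lambda>x. x i) \<in> borel_measurable ?N"
    proof (rule borel_measurableI_le)
      fix a
      \<comment> \<open>The top element \<open>t\<close> in the other coordinates imposes no
        constraint, so a half-space is itself a lower box.\<close>
      have "{x \<in> space ?N. x i \<le> a} = PiE I (\<lambda>j. S \<inter> {..if j = i then a else t})"
        using i top by (auto simp: PiE_iff extensional_def split: if_splits)
      also have "\<dots> \<in> sets ?N" by auto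
      finally show "{x \<in> space ?N. x i \<le> a} \<in> sets ?N" .
    qed
  qed
  note proj = this
  have "sets (PiM I (\<lambda>_. restrict_space borel S)) \<subseteq> sets ?N"
  proof (rule sets_PiM_in_sets)
    show "space ?N = (\<Pi>\<^sub>E i\<in>I. space (restrict_space borel S))"
      by (simp add: space_restrict_space)
    show "{x \<in> space ?N. x i \<in> A} \<in> sets ?N"
      if "i \<in> I" "A \<in> sets (restrict_space borel S)" for i A
      using measurable_sets[OF proj[OF that(1)] that(2)]
      by (simp add: vimage_def Int_def conj_commute del: sets_measure_of)
  qed
  then show "sets (PiM I (\<lambda>_. restrict_space borel S)) \<subseteq> sigma_sets (I \<rightarrow>\<^sub>E S) ?G"
    by simp
  have "?G \<subseteq> sets (PiM I (\<lambda>_. restrict_space borel S))"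
    using assms by (auto intro!: sets_PiM_I_finite simp: sets_restrict_space)
  moreover have "(I \<rightarrow>\<^sub>E S) = space (PiM I (\<lambda>_. restrict_space borel S))"
    by (simp add: space_PiM space_restrict_space)
  ultimately show "sigma_sets (I \<rightarrow>\<^sub>E S) ?G \<subseteq> sets (PiM I (\<lambda>_. restrict_space borel S))"
    by (metis sets.sigma_sets_subset)
qed

text \<open>Lower boxes form a generator closed under intersection, by coordinatewise
  \<open>min\<close>, and contain the whole space, by the top element. The general \<open>S\<close>
  serves both the cube (\<open>{0..1}\<close>) and the extended reals (\<open>UNIV\<close>, with top
  \<open>\<infinity>\<close>).\<close>

lemma prob_eqI_lower_boxes:
  fixes S :: "'a::{linorder_topology, second_countable_topology} set"
  assumes "finite I" and top: "t \<in> S" "\<And>s. s \<in> S \<Longrightarrow> s \<le> t" and S: "S \<in> sets borel"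
    and M: "prob_space M" "sets M = sets (PiM I (\<lambda>_. restrict_space borel S))"
    and N: "prob_space N" "sets N = sets (PiM I (\<lambda>_. restrict_space borel S))"
    and eq: "\<And>x. measure M (PiE I (\<lambda>i. S \<inter> {..x i})) = measure N (PiE I (\<lambda>i. S \<inter> {..x i}))"
  shows "M = N"
proof (rule measure_eqI_generator_eq)
  let ?G = "range (\<lambda>x. PiE I (\<lambda>i. S \<inter> {..x i}))"
  interpret M: prob_space M by fact
  interpret N: prob_space N by fact
  have "PiE I (\<lambda>i. S \<inter> {..x i}) \<inter> PiE I (\<lambda>i. S \<inter> {..y i}) = PiE I (\<lambda>i. S \<inter> {..min (x i) (y i)})" for x y
    by (auto simp: PiE_Int intro!: PiE_cong)
  then show "Int_stable ?G"
    by (auto simp: Int_stable_def)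
  show "?G \<subseteq> Pow (I \<rightarrow>\<^sub>E S)" by (auto simp: PiE_iff)
  show "sets M = sigma_sets (I \<rightarrow>\<^sub>E S) ?G" "sets N = sigma_sets (I \<rightarrow>\<^sub>E S) ?G"
    using sets_PiM_lower_boxes[OF assms(1-4)] M N by auto
  show "emeasure M X = emeasure N X" if "X \<in> ?G" for X
    using that eq by (auto simp: M.emeasure_eq_measure N.emeasure_eq_measure)
  have "PiE I (\<lambda>i. S \<inter> {..t}) = (I \<rightarrow>\<^sub>E S)"
    using top by (auto intro!: PiE_cong)
  then show "range (\<lambda>_::nat. I \<rightarrow>\<^sub>E S) \<subseteq> ?G"
    by (intro image_subsetI range_eqI[where x = "\<lambda>_. t"]) (rule sym)
  show "emeasure M (I \<rightarrow>\<^sub>E S) \<noteq> \<infinity>" by (simp add: M.emeasure_eq_measure)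
qed auto

section \<open>Measures determined by their values on lower boxes\<close>

lemma space_cube_borel [simp]: "space (cube_borel d) = cube d"
  by (simp add: cube_borel_def cube_def space_PiM space_restrict_space)

lemma measurable_cube_component:
  assumes "i \<in> {1..d}"
  shows "(\<lambda>x. x i) \<in> borel_measurable (cube_borel d)"
  using measurable_component_singleton[OF assms, of "\<lambda>_. restrict_space borel {0..1}"]
  by (auto simp: cube_borel_def measurable_restrict_space2_iff)

lemma cube_box_eq:
  assumes "u \<in> cube d"
  shows "PiE {1..d} (\<lambda>i. {0..u i}) = {x \<in> cube d. \<forall>i\<in>{1..d}. x i \<le> u i}"
proof -
  have "t \<le> 1" if "i \<in> {1..d}" "t \<le> u i" for i t
    using assms that by (force simp: cube_def PiE_iff)
  then show ?thesis unfolding cube_def by (auto simp: PiE_iff extensional_def)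
qed

text \<open>The predicate inside the definite description of \<open>copula_measure\<close>, named so
  that facts can be proved for an arbitrary witness before existence is available.\<close>

definition is_copula_measure :: "nat \<Rightarrow> ((nat \<Rightarrow> real) \<Rightarrow> real) \<Rightarrow> (nat \<Rightarrow> real) measure \<Rightarrow> bool" where
  "is_copula_measure d C Q \<longleftrightarrow> prob_space Q \<and> sets Q = sets (cube_borel d) \<and>
        (\<forall>u\<in>cube d. measure Q (PiE {1..d} (\<lambda>i. {0..u i})) = C u)"

lemma is_copula_measure_unique:
  assumes "is_copula_measure d C Q" "is_copula_measure d C R"
  shows "Q = R"
proof (rule prob_eqI_lower_boxes[where S = "{0..1}" and t = 1 and I = "{1..d}"])
  fix x :: "nat \<Rightarrow> real"
  show "measure Q (PiE {1..d} (\<lambda>i. {0..1} \<inter> {..x i})) = measure R (PiE {1..d} (\<lambda>i. {0..1} \<inter> {..x i}))"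
  proof (cases "\<forall>i\<in>{1..d}. 0 \<le> x i")
    case True
    \<comment> \<open>The predicate controls only corners in the cube. Other corners are truncated
      at 1, and a negative coordinate makes the box empty.\<close>
    let ?u = "\<lambda>i\<in>{1..d}. min 1 (x i)"
    have "?u \<in> cube d" using True by (auto simp: cube_def)
    moreover have "PiE {1..d} (\<lambda>i. {0..1} \<inter> {..x i}) = PiE {1..d} (\<lambda>i. {0..?u i})"
      by (intro PiE_cong) auto
    ultimately show ?thesis using assms unfolding is_copula_measure_def by metis
  next
    case False
    then obtain i where "i \<in> {1..d}" "{0..1} \<inter> {..x i} = {}" by force
    then have "PiE {1..d} (\<lambda>i. {0..1} \<inter> {..x i}) = {}" by (auto simp: PiE_eq_empty_iff)
    then show ?thesis by simp
  qed
qed (use assms in \<open>auto simp: is_copula_measure_def cube_borel_def\<close>)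

lemma copula_measure_eqI: "is_copula_measure d C Q \<Longrightarrow> copula_measure d C = Q"
  unfolding copula_measure_def is_copula_measure_def[symmetric]
  by (rule the_equality) (auto intro: is_copula_measure_unique)

lemma df_measure_eqI:
  assumes "prob_space Q" "sets Q = sets (ext_borel d)"
    "\<And>x. x \<in> ext_space d \<Longrightarrow> measure Q (PiE {1..d} (\<lambda>i. {..x i})) = H x"
  shows "df_measure d H = Q"
  unfolding df_measure_def
proof (rule the_equality)
  show "prob_space Q \<and> sets Q = sets (ext_borel d) \<and>
    (\<forall>x\<in>ext_space d. measure Q (PiE {1..d} (\<lambda>i. {..x i})) = H x)"
    using assms by blast
  fix R assume R: "prob_space R \<and> sets R = sets (ext_borel d) \<and>
    (\<forall>x\<in>ext_space d. measure R (PiE {1..d} (\<lambda>i. {..x i})) = H x)"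
  show "R = Q"
  proof (rule prob_eqI_lower_boxes[where S = UNIV and t = \<infinity> and I = "{1..d}"])
    fix x :: "nat \<Rightarrow> ereal"
    have "restrict x {1..d} \<in> ext_space d" by (auto simp: ext_space_def)
    moreover have "PiE {1..d} (\<lambda>i. UNIV \<inter> {..x i}) = PiE {1..d} (\<lambda>i. {..restrict x {1..d} i})"
      by (intro PiE_cong) auto
    ultimately show "measure R (PiE {1..d} (\<lambda>i. UNIV \<inter> {..x i})) = measure Q (PiE {1..d} (\<lambda>i. UNIV \<inter> {..x i}))"
      using R assms by metis
  qed (use R assms in \<open>auto simp: ext_borel_def cong: sets_PiM_cong\<close>)
qed

text \<open>Inclusion-exclusion: the indicator of \<open>{u i<..v i}\<close> is the difference of
  those of \<open>{0..v i}\<close> and \<open>{0..u i}\<close>; expanding the product over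
  \<open>i\<close> and integrating gives the sum.\<close>

lemma alternating_sum_eq_measure_box:
  fixes u v :: "nat \<Rightarrow> real"
  assumes Q: "prob_space Q" "sets Q = sets (cube_borel d)"
    and u: "u \<in> cube d" and v: "v \<in> cube d" and uv: "\<And>i. i \<in> {1..d} \<Longrightarrow> u i \<le> v i"
  shows "(\<Sum>K\<in>Pow {1..d}. (-1) ^ (d - card K) *
      measure Q (PiE {1..d} (\<lambda>i. {0..(\<lambda>i\<in>{1..d}. if i \<in> K then v i else u i) i}))) =
    measure Q (PiE {1..d} (\<lambda>i. {u i<..v i}))"
proof -
  interpret prob_space Q by fact
  let ?w = "\<lambda>K. \<lambda>i\<in>{1..d}. if i \<in> K then v i else u i"
  let ?B = "\<lambda>K. PiE {1..d} (\<lambda>i. {0..?w K i})"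
  have sp: "space Q = cube d" using sets_eq_imp_space_eq[OF Q(2)] by simp
  have B: "?B K \<in> sets Q" for K
    unfolding Q(2) cube_borel_def using u v
    by (intro sets_PiM_I_finite) (auto simp: sets_restrict_space_iff cube_def PiE_iff)
  have E: "PiE {1..d} (\<lambda>i. {u i<..v i}) \<in> sets Q"
    unfolding Q(2) cube_borel_def
  proof (rule sets_PiM_I_finite)
    fix i assume "i \<in> {1..d}"
    then have "0 \<le> u i" "v i \<le> 1" using u v by (auto simp: cube_def PiE_iff)
    then show "{u i<..v i} \<in> sets (restrict_space borel {0..1})"
      by (auto simp: sets_restrict_space_iff)
  qed simp
  have ind: "(\<Sum>K\<in>Pow {1..d}. (-1) ^ (d - card K) * indicat_real (?B K) x) =
      indicat_real (PiE {1..d} (\<lambda>i. {u i<..v i})) x" if x: "x \<in> cube d" for x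
  proof -
    have prod_ind: "indicat_real (PiE {1..d} A) x = (\<Prod>i\<in>{1..d}. indicat_real (A i) (x i))" for A
      using x by (auto simp: indicator_def cube_def PiE_iff prod_zero_iff)
    have "indicat_real (PiE {1..d} (\<lambda>i. {u i<..v i})) x =
        (\<Prod>i\<in>{1..d}. indicat_real {0..v i} (x i) - indicat_real {0..u i} (x i))"
      unfolding prod_ind
    proof (intro prod.cong refl)
      fix i assume i: "i \<in> {1..d}"
      then have "0 \<le> x i" using x by (auto simp: cube_def PiE_iff)
      then show "indicat_real {u i<..v i} (x i) = indicat_real {0..v i} (x i) - indicat_real {0..u i} (x i)"
        using uv[OF i] by (auto simp: indicator_def)
    qed
    also have "\<dots> = (\<Sum>K\<in>Pow {1..d}. (-1) ^ (card {1..d} - card K) *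
        (\<Prod>i\<in>K. indicat_real {0..v i} (x i)) * (\<Prod>i\<in>{1..d} - K. indicat_real {0..u i} (x i)))"
      by (rule prod_diff_conv_sum') simp
    also have "\<dots> = (\<Sum>K\<in>Pow {1..d}. (-1) ^ (d - card K) * indicat_real (?B K) x)"
    proof (intro sum.cong refl)
      fix K assume K: "K \<in> Pow {1..d}"
      have "indicat_real (?B K) x = (\<Prod>i\<in>K \<union> ({1..d} - K). indicat_real {0..?w K i} (x i))"
        unfolding prod_ind using K by (simp add: Un_absorb1)
      also have "\<dots> = (\<Prod>i\<in>K. indicat_real {0..?w K i} (x i)) * (\<Prod>i\<in>{1..d} - K. indicat_real {0..?w K i} (x i))"
        using K finite_subset[of K "{1..d}"] by (intro prod.union_disjoint) auto
      also have "\<dots> = (\<Prod>i\<in>K. indicat_real {0..v i} (x i)) * (\<Prod>i\<in>{1..d} - K. indicat_real {0..u i} (x i))"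
        using K by (intro arg_cong2[where f = times] prod.cong) auto
      finally show "(-1) ^ (card {1..d} - card K) * (\<Prod>i\<in>K. indicat_real {0..v i} (x i)) *
          (\<Prod>i\<in>{1..d} - K. indicat_real {0..u i} (x i)) = (-1) ^ (d - card K) * indicat_real (?B K) x"
        by simp
    qed
    finally show ?thesis ..
  qed
  define P where "P = Pow {1..d}"
  define c :: "nat set \<Rightarrow> real" where "c K = (-1) ^ (d - card K)" for K
  define B' where "B' K = ?B K" for K
  define E' where "E' = PiE {1..d} (\<lambda>i. {u i<..v i})"
  have [measurable]: "B' K \<in> sets Q" "E' \<in> sets Q" for K
    using B E by (simp_all only: B'_def E'_def)
  have ind': "(\<Sum>K\<in>P. c K * indicat_real (B' K) x) = indicat_real E' x" if "x \<in> space Q" for x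
    using ind that unfolding B'_def c_def E'_def P_def sp by blast
  have "(\<Sum>K\<in>P. c K * measure Q (B' K)) = (\<Sum>K\<in>P. (\<integral>x. c K * indicat_real (B' K) x \<partial>Q))"
    by simp
  also have "\<dots> = (\<integral>x. (\<Sum>K\<in>P. c K * indicat_real (B' K) x) \<partial>Q)"
    by (rule Bochner_Integration.integral_sum[symmetric])
       (intro integrable_mult_right integrable_real_indicator, auto simp: less_top[symmetric])
  also have "\<dots> = (\<integral>x. indicat_real E' x \<partial>Q)"
    using ind' by (intro Bochner_Integration.integral_cong refl)
  also have "\<dots> = measure Q E'"
    by simp
  finally show ?thesis unfolding B'_def c_def E'_def P_def .
qed

text \<open>The means of producing copulas: uniform marginals are all that has to be checked. It is
  applied to the law of the transformed order statistics and to the minimizing example.\<close>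

lemma copula_of_measure:
  assumes Q: "prob_space Q" "sets Q = sets (cube_borel d)"
    and marg: "\<And>i t. i \<in> {1..d} \<Longrightarrow> 0 \<le> t \<Longrightarrow> t \<le> 1 \<Longrightarrow> measure Q {x \<in> cube d. x i \<le> t} = t"
  defines "D \<equiv> \<lambda>u\<in>cube d. measure Q (PiE {1..d} (\<lambda>i. {0..u i}))"
  shows "copula d D" "is_copula_measure d D Q"
proof -
  interpret prob_space Q by fact
  have sp: "space Q = cube d" using sets_eq_imp_space_eq[OF Q(2)] by simp
  show "is_copula_measure d D Q" using Q by (simp add: is_copula_measure_def D_def)
  show "copula d D"
    unfolding copula_def
  proof (intro conjI ballI impI)
    show "D \<in> cube d \<rightarrow>\<^sub>E {0..1}" by (auto simp: D_def)
  next
    fix u v assume uv: "u \<in> cube d" "v \<in> cube d" "\<forall>i\<in>{1..d}. u i \<le> v i"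
    have "(\<lambda>i\<in>{1..d}. if i \<in> K then v i else u i) \<in> cube d" for K
      using uv by (auto simp: cube_def PiE_iff)
    then have "(\<Sum>K\<in>Pow {1..d}. (-1) ^ (d - card K) * D (\<lambda>i\<in>{1..d}. if i \<in> K then v i else u i)) =
      measure Q (PiE {1..d} (\<lambda>i. {u i<..v i}))"
      using alternating_sum_eq_measure_box[OF Q uv(1,2)] uv(3) by (simp add: D_def)
    then show "0 \<le> (\<Sum>K\<in>Pow {1..d}. (-1) ^ (d - card K) * D (\<lambda>i\<in>{1..d}. if i \<in> K then v i else u i))"
      by simp
  next
    fix u assume u: "u \<in> cube d" and "\<exists>i\<in>{1..d}. u i = 0"
    then obtain i where i: "i \<in> {1..d}" "u i = 0" by blast
    have "{x \<in> cube d. x i \<le> 0} \<in> sets Q"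
      using measurable_cube_component[OF i(1)] unfolding Q(2) space_cube_borel[symmetric]
      by measurable
    then have "measure Q (PiE {1..d} (\<lambda>i. {0..u i})) \<le> measure Q {x \<in> cube d. x i \<le> 0}"
      using i unfolding cube_box_eq[OF u] by (intro finite_measure_mono) fastforce+
    then show "D u = 0" using marg[of i 0] i u by (simp add: D_def measure_le_0_iff)
  next
    fix u i assume u: "u \<in> cube d" and i: "i \<in> {1..d}" and rest: "\<forall>j\<in>{1..d} - {i}. u j = 1"
    have "x j \<le> u j" if "x \<in> cube d" "x i \<le> u i" "j \<in> {1..d}" for x j
    proof (cases "j = i")
      case False
      then have "u j = 1" using rest that(3) by blast
      then show ?thesis using that(1,3) unfolding cube_def by (force simp: PiE_iff)
    qed (use that in simp)
    then have "PiE {1..d} (\<lambda>i. {0..u i}) = {x \<in> cube d. x i \<le> u i}"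
      unfolding cube_box_eq[OF u] using i by blast
    moreover have "0 \<le> u i" "u i \<le> 1" using u i by (auto simp: cube_def PiE_iff)
    ultimately show "D u = u i" using marg[OF i] u by (simp add: D_def)
  qed
qed

subsection \<open>Existence of the measure of a copula\<close>

text \<open>The alternating sum of \<open>copula\<close>, for corners that need not be extensional:
  the restriction inside allows point updates such as \<open>b(i := m)\<close>.\<close>

definition box_volume :: "nat \<Rightarrow> ((nat \<Rightarrow> real) \<Rightarrow> real) \<Rightarrow> (nat \<Rightarrow> real) \<Rightarrow> (nat \<Rightarrow> real) \<Rightarrow> real" where
  "box_volume d C a b =
     (\<Sum>K\<in>Pow {1..d}. (-1) ^ (d - card K) * C (\<lambda>i\<in>{1..d}. if i \<in> K then b i else a i))"

lemma box_volume_cong: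
  assumes "\<And>i. i \<in> {1..d} \<Longrightarrow> a i = a' i" "\<And>i. i \<in> {1..d} \<Longrightarrow> b i = b' i"
  shows "box_volume d C a b = box_volume d C a' b'"
proof -
  have "(\<lambda>i\<in>{1..d}. if i \<in> K then b i else a i) = (\<lambda>i\<in>{1..d}. if i \<in> K then b' i else a' i)" for K
    using assms by (intro restrict_ext) auto
  then show ?thesis by (simp add: box_volume_def)
qed

text \<open>Pair each \<open>K\<close> avoiding \<open>i\<close> with \<open>insert i K\<close>: the
  two terms carry opposite signs and differ only in coordinate \<open>i\<close>. Here
  \<open>W\<close> is the alternating sum over the other coordinates, so splitting a box becomes
  telescoping.\<close>

lemma box_volume_coordinate:
  assumes i: "i \<in> {1..d}"
  obtains W where "\<And>s t. box_volume d C (a(i := s)) (b(i := t)) = W t - W s"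
proof -
  define J where "J = {1..d} - {i}"
  have J: "{1..d} = insert i J" "i \<notin> J" "finite J" "card J = d - 1"
    using i by (auto simp: J_def)
  define g where "g K t = C (\<lambda>j\<in>{1..d}. if j = i then t else if j \<in> K then b j else a j)" for K t
  define W where "W t = (\<Sum>K\<in>Pow J. (-1) ^ (d - 1 - card K) * g K t)" for t
  have "box_volume d C (a(i := s)) (b(i := t)) = W t - W s" for s t
  proof -
    let ?h = "\<lambda>K. (-1) ^ (d - card K) * C (\<lambda>j\<in>{1..d}. if j \<in> K then (b(i := t)) j else (a(i := s)) j)"
    have "box_volume d C (a(i := s)) (b(i := t)) = sum ?h (Pow J \<union> insert i ` Pow J)"
      unfolding box_volume_def by (subst (2) J(1)) (simp add: Pow_insert)
    also have "\<dots> = sum ?h (Pow J) + sum ?h (insert i ` Pow J)"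
      using J by (intro sum.union_disjoint) auto
    also have "sum ?h (insert i ` Pow J) = (\<Sum>K\<in>Pow J. ?h (insert i K))"
      using J(2) by (subst sum.reindex) (auto simp: inj_on_def)
    also have "\<dots> = W t"
      unfolding W_def
    proof (intro sum.cong refl)
      fix K assume K: "K \<in> Pow J"
      then have "finite K" "i \<notin> K" using J finite_subset by auto
      then have "d - card (insert i K) = d - 1 - card K" by simp
      moreover have "(\<lambda>j\<in>{1..d}. if j \<in> insert i K then (b(i := t)) j else (a(i := s)) j) =
          (\<lambda>j\<in>{1..d}. if j = i then t else if j \<in> K then b j else a j)"
        by (intro restrict_ext) auto
      ultimately show "?h (insert i K) = (-1) ^ (d - 1 - card K) * g K t"
        by (simp only: g_def)
    qed
    also have "sum ?h (Pow J) = - W s"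
      unfolding W_def sum_negf[symmetric]
    proof (intro sum.cong refl)
      fix K assume K: "K \<in> Pow J"
      then have "i \<notin> K" "card K \<le> d - 1" using J card_mono[of J K] by auto
      then have "d - card K = Suc (d - 1 - card K)" using i by auto
      moreover have "(\<lambda>j\<in>{1..d}. if j \<in> K then (b(i := t)) j else (a(i := s)) j) =
          (\<lambda>j\<in>{1..d}. if j = i then s else if j \<in> K then b j else a j)"
        using \<open>i \<notin> K\<close> by (intro restrict_ext) auto
      ultimately show "?h K = - ((-1) ^ (d - 1 - card K) * g K s)"
        by (simp only: g_def power_Suc mult_minus1 mult_minus_left)
    qed
    finally show ?thesis by (simp add: fun_upd_def)
  qed
  then show ?thesis by (rule that)
qed

lemma box_volume_split:
  assumes "i \<in> {1..d}"
  shows "box_volume d C a b = box_volume d C a (b(i := m)) + box_volume d C (a(i := m)) b"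
proof -
  obtain W where W: "\<And>s t. box_volume d C (a(i := s)) (b(i := t)) = W t - W s"
    using box_volume_coordinate[OF assms] by blast
  show ?thesis
    using W[of "a i" "b i"] W[of "a i" m] W[of m "b i"] by simp
qed

text \<open>Splitting at \<open>a i\<close> changes neither corner, so the volume equals twice
  itself.\<close>

lemma box_volume_degenerate:
  assumes "i \<in> {1..d}" "a i = b i"
  shows "box_volume d C a b = 0"
  using box_volume_split[OF assms(1), of C a b "a i"] assms(2) by (metis add_0_left add_right_cancel fun_upd_triv)

definition subbox :: "nat \<Rightarrow> (nat \<Rightarrow> real) \<Rightarrow> (nat \<Rightarrow> real) \<Rightarrow> bool" where
  "subbox d a b \<longleftrightarrow> (\<forall>i\<in>{1..d}. 0 \<le> a i \<and> a i \<le> b i \<and> b i \<le> 1)"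

lemma box_volume_nonneg:
  assumes "copula d C" "subbox d a b"
  shows "0 \<le> box_volume d C a b"
proof -
  have "restrict a {1..d} \<in> cube d" "restrict b {1..d} \<in> cube d"
    using assms(2) by (fastforce simp: cube_def subbox_def)+
  moreover have "\<forall>i\<in>{1..d}. restrict a {1..d} i \<le> restrict b {1..d} i"
    using assms(2) by (simp add: subbox_def)
  moreover have "\<forall>u\<in>cube d. \<forall>v\<in>cube d. (\<forall>i\<in>{1..d}. u i \<le> v i) \<longrightarrow> 0 \<le> box_volume d C u v"
    using assms(1) unfolding copula_def box_volume_def by blast
  ultimately have "0 \<le> box_volume d C (restrict a {1..d}) (restrict b {1..d})" by blast
  also have "\<dots> = box_volume d C a b" by (rule box_volume_cong) auto
  finally show ?thesis .
qed

text \<open>Lower the coordinates of the upper corner one at a time; each move cuts off a box of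
  nonnegative volume. In the induction \<open>J\<close> holds the coordinates already
  lowered.\<close>

lemma box_volume_mono_upper:
  assumes C: "copula d C" and ab: "subbox d a b" and b': "\<And>i. i \<in> {1..d} \<Longrightarrow> a i \<le> b' i \<and> b' i \<le> b i"
  shows "box_volume d C a b' \<le> box_volume d C a b"
proof -
  have "box_volume d C a (\<lambda>i. if i \<in> J then b' i else b i) \<le> box_volume d C a b" if "finite J" "J \<subseteq> {1..d}" for J
    using that
  proof (induction J)
    case (insert i J)
    let ?b = "\<lambda>j. if j \<in> J then b' j else b j"
    have i: "i \<in> {1..d}" using insert.prems by auto
    have upd: "?b(i := b' i) = (\<lambda>j. if j \<in> insert i J then b' j else b j)" by auto
    have "subbox d (a(i := b' i)) ?b"
      unfolding subbox_def
    proof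
      fix j assume "j \<in> {1..d}"
      then show "0 \<le> (a(i := b' i)) j \<and> (a(i := b' i)) j \<le> ?b j \<and> ?b j \<le> 1"
        using ab[unfolded subbox_def, rule_format, of j] b'[of j] insert.hyps by auto
    qed
    then have "box_volume d C a (?b(i := b' i)) \<le> box_volume d C a ?b"
      using box_volume_split[OF i, of C a ?b "b' i"] box_volume_nonneg[OF C] by simp
    then show ?case using insert unfolding upd by simp
  qed simp
  from this[of "{1..d}"] have "box_volume d C a (\<lambda>i. if i \<in> {1..d} then b' i else b i) \<le> box_volume d C a b" by simp
  also have "box_volume d C a (\<lambda>i. if i \<in> {1..d} then b' i else b i) = box_volume d C a b'"
    by (rule box_volume_cong) auto
  finally show ?thesis .
qed

lemma copula_grounded:
  assumes "copula d C" "u \<in> cube d" "i \<in> {1..d}" "u i = 0"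
  shows "C u = 0"
  using assms unfolding copula_def by blast

lemma copula_marginal:
  assumes "copula d C" "u \<in> cube d" "i \<in> {1..d}" "\<And>j. j \<in> {1..d} \<Longrightarrow> j \<noteq> i \<Longrightarrow> u j = 1"
  shows "C u = u i"
  using assms unfolding copula_def by blast

text \<open>Every term with \<open>K\<close> a proper subset has a zero coordinate and vanishes
  because \<open>C\<close> is grounded.\<close>

lemma box_volume_zero:
  assumes C: "copula d C" and u: "u \<in> cube d"
  shows "box_volume d C (\<lambda>_. 0) u = C u"
proof -
  have "C (\<lambda>i\<in>{1..d}. if i \<in> K then u i else 0) = 0" if "K \<in> Pow {1..d} - {{1..d}}" for K
  proof -
    obtain i where i: "i \<in> {1..d}" "i \<notin> K" using \<open>K \<in> Pow {1..d} - {{1..d}}\<close> by blast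
    have "(\<lambda>i\<in>{1..d}. if i \<in> K then u i else 0) \<in> cube d" using u by (auto simp: cube_def PiE_iff)
    from copula_grounded[OF C this i(1)] i show ?thesis by simp
  qed
  then have "box_volume d C (\<lambda>_. 0) u =
      (\<Sum>K\<in>{{1..d}}. (-1) ^ (d - card K) * C (\<lambda>i\<in>{1..d}. if i \<in> K then u i else 0))"
    unfolding box_volume_def by (intro sum.mono_neutral_right) auto
  also have "\<dots> = C (\<lambda>i\<in>{1..d}. u i)"
    by (simp cong: restrict_cong)
  also have "(\<lambda>i\<in>{1..d}. u i) = u" using u by (simp add: cube_def PiE_iff extensional_restrict)
  finally show ?thesis .
qed

text \<open>
  A point \<open>p\<close> of \<open>[0, V)\<close>, where \<open>V\<close> is the volume of the box \<open>(a, b]\<close>, is routed through \<open>n\<close> successive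
  bisections of that box, in coordinates \<open>k, k + 1, \<dots>\<close> taken cyclically: the initial segment of length
  the volume of the lower half goes to the lower half, the rest is shifted to the origin and goes to the
  upper half. The result is the pair of corners of the box that is reached.
\<close>

fun cell :: "nat \<Rightarrow> ((nat \<Rightarrow> real) \<Rightarrow> real) \<Rightarrow> nat \<Rightarrow> nat \<Rightarrow> (nat \<Rightarrow> real) \<Rightarrow> (nat \<Rightarrow> real) \<Rightarrow> real \<Rightarrow>
    (nat \<Rightarrow> real) \<times> (nat \<Rightarrow> real)" where
  "cell d C 0 k a b p = (a, b)"
| "cell d C (Suc n) k a b p =
     (let i = k mod d + 1; m = (a i + b i) / 2; l = box_volume d C a (b(i := m)) in
      if p < l then cell d C n (Suc k) a (b(i := m)) p
      else cell d C n (Suc k) (a(i := m)) b (p - l))"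

section \<open>Geometry and Lebesgue mass of the nested cells\<close>

lemma split_index: "0 < d \<Longrightarrow> k mod d + 1 \<in> {1..d::nat}"
  by (simp add: Suc_leI)

lemma subbox_halves:
  assumes "subbox d a b" "i \<in> {1..d}"
  shows "subbox d a (b(i := (a i + b i) / 2))" "subbox d (a(i := (a i + b i) / 2)) b"
proof -
  have "0 \<le> a i" "a i \<le> b i" "b i \<le> 1" using assms unfolding subbox_def by blast+
  then have "a i \<le> (a i + b i) / 2" "(a i + b i) / 2 \<le> b i" "0 \<le> (a i + b i) / 2" "(a i + b i) / 2 \<le> 1"
    by simp_all
  then show "subbox d a (b(i := (a i + b i) / 2))" "subbox d (a(i := (a i + b i) / 2)) b"
    using assms(1) by (simp_all add: subbox_def)
qed

text \<open>The recursion of \<open>cell\<close> peels off the first bisection, whereas nesting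
  concerns the last one; hence the induction over all starting boxes, indices and points.\<close>

lemma cell_nested:
  assumes "0 < d" "subbox d a b"
  shows "subbox d (fst (cell d C n k a b p)) (snd (cell d C n k a b p)) \<and>
    (\<forall>i\<in>{1..d}. fst (cell d C n k a b p) i \<le> fst (cell d C (Suc n) k a b p) i \<and>
      snd (cell d C (Suc n) k a b p) i \<le> snd (cell d C n k a b p) i)"
  using assms(2)
proof (induction n arbitrary: k a b p)
  case 0
  have "a (k mod d + 1) \<le> b (k mod d + 1)"
    using 0 split_index[OF assms(1), of k] unfolding subbox_def by blast
  then show ?case using 0 by (auto simp: Let_def)
next
  case (Suc n)
  let ?i = "k mod d + 1"
  let ?m = "(a ?i + b ?i) / 2"
  note halves = subbox_halves[OF Suc.prems split_index[OF assms(1), of k]]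
  show ?case
  proof (cases "p < box_volume d C a (b(?i := ?m))")
    case True
    then have "cell d C (Suc n') k a b p = cell d C n' (Suc k) a (b(?i := ?m)) p" for n'
      by (simp add: Let_def)
    then show ?thesis using Suc.IH[OF halves(1)] by presburger
  next
    case False
    then have "cell d C (Suc n') k a b p =
        cell d C n' (Suc k) (a(?i := ?m)) b (p - box_volume d C a (b(?i := ?m)))" for n'
      by (simp add: Let_def)
    then show ?thesis using Suc.IH[OF halves(2)] by presburger
  qed
qed

text \<open>Only one side is halved per step, so the exponent counts the steps that bisect
  coordinate \<open>i\<close>.\<close>

lemma cell_width:
  shows "snd (cell d C n k a b p) i - fst (cell d C n k a b p) i =
    (b i - a i) / 2 ^ card {j \<in> {k..<k + n}. j mod d + 1 = i}"
proof (induction n arbitrary: k a b p)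
  case (Suc n)
  let ?i = "k mod d + 1"
  let ?m = "(a ?i + b ?i) / 2"
  define N where "N = card {j \<in> {Suc k..<Suc k + n}. j mod d + 1 = i}"
  have "{k..<k + Suc n} = insert k {Suc k..<Suc k + n}" by auto
  then have "{j \<in> {k..<k + Suc n}. j mod d + 1 = i} =
      (if ?i = i then insert k {j \<in> {Suc k..<Suc k + n}. j mod d + 1 = i}
       else {j \<in> {Suc k..<Suc k + n}. j mod d + 1 = i})"
    by auto
  then have N: "card {j \<in> {k..<k + Suc n}. j mod d + 1 = i} = (if ?i = i then Suc N else N)"
    by (simp add: N_def)
  obtain a' b' p' where "cell d C (Suc n) k a b p = cell d C n (Suc k) a' b' p'"
    "b' i - a' i = (if ?i = i then (b i - a i) / 2 else b i - a i)"
  proof (cases "p < box_volume d C a (b(?i := ?m))")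
    case True
    then show ?thesis
      by (intro that[of a "b(?i := ?m)" p]) (simp_all add: Let_def field_simps)
  next
    case False
    then show ?thesis
      by (intro that[of "a(?i := ?m)" b "p - box_volume d C a (b(?i := ?m))"])
        (simp_all add: Let_def field_simps)
  qed
  then show ?case
    unfolding N using Suc.IH[of "Suc k" a' b' p', folded N_def] by (simp del: cell.simps)
qed simp

text \<open>As a function of \<open>p\<close>, \<open>cell\<close> takes finitely many values, each
  on a Borel set, which is why \<open>P\<close> can be arbitrary.\<close>

lemma cell_measurable: "{p. P (cell d C n k a b p)} \<in> sets borel"
proof (induction n arbitrary: k a b)
  case 0
  then show ?case by simp
next
  case (Suc n)
  let ?i = "k mod d + 1"
  let ?m = "(a ?i + b ?i) / 2"
  let ?l = "box_volume d C a (b(?i := ?m))"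
  have [measurable]: "Measurable.pred borel (\<lambda>p. P (cell d C n (Suc k) a (b(?i := ?m)) p))"
    using Suc by (simp add: pred_def)
  have [measurable]: "Measurable.pred borel (\<lambda>p. P (cell d C n (Suc k) (a(?i := ?m)) b p))"
    using Suc by (simp add: pred_def)
  have "Measurable.pred borel (\<lambda>p. (p < ?l \<and> P (cell d C n (Suc k) a (b(?i := ?m)) p)) \<or>
      (\<not> p < ?l \<and> P (cell d C n (Suc k) (a(?i := ?m)) b (p - ?l))))"
    by measurable
  also have "(\<lambda>p. (p < ?l \<and> P (cell d C n (Suc k) a (b(?i := ?m)) p)) \<or>
      (\<not> p < ?l \<and> P (cell d C n (Suc k) (a(?i := ?m)) b (p - ?l)))) =
      (\<lambda>p. P (cell d C (Suc n) k a b p))"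
    by (auto simp: Let_def)
  finally show ?case by (simp only: pred_def) simp
qed

definition cell_mass where
  "cell_mass d C n k a b P = measure lborel {p \<in> {0..<box_volume d C a b}. P (cell d C n k a b p)}"

text \<open>The interval \<open>[0, l + r)\<close> is \<open>[0, l)\<close> followed by the
  translate of \<open>[0, r)\<close> by \<open>l\<close>; translation invariance of Lebesgue measure
  moves the second piece back to the origin.\<close>

lemma cell_mass_Suc:
  fixes k :: nat and a b :: "nat \<Rightarrow> real"
  assumes C: "copula d C" and d: "0 < d" and ab: "subbox d a b"
  defines "i \<equiv> k mod d + 1"
  defines "m \<equiv> (a i + b i) / 2"
  shows "cell_mass d C (Suc n) k a b P =
    cell_mass d C n (Suc k) a (b(i := m)) P + cell_mass d C n (Suc k) (a(i := m)) b P"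
proof -
  define l where "l = box_volume d C a (b(i := m))"
  define r where "r = box_volume d C (a(i := m)) b"
  have i: "i \<in> {1..d}" unfolding i_def by (rule split_index[OF d])
  have lr: "0 \<le> l" "0 \<le> r" "box_volume d C a b = l + r"
    using box_volume_nonneg[OF C] subbox_halves[OF ab i] box_volume_split[OF i]
    unfolding l_def r_def m_def by auto
  define A where "A = {p \<in> {0..<l}. P (cell d C n (Suc k) a (b(i := m)) p)}"
  define B where "B = {p \<in> {0..<r}. P (cell d C n (Suc k) (a(i := m)) b p)}"
  have "A = {0..<l} \<inter> {p. P (cell d C n (Suc k) a (b(i := m)) p)}"
    "B = {0..<r} \<inter> {p. P (cell d C n (Suc k) (a(i := m)) b p)}"
    by (auto simp: A_def B_def)
  then have [measurable]: "A \<in> sets borel" "B \<in> sets borel"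
    using cell_measurable by auto
  have eq: "{p \<in> {0..<box_volume d C a b}. P (cell d C (Suc n) k a b p)} = A \<union> (+) l ` B"
  proof (intro set_eqI iffI)
    fix p assume p: "p \<in> {p \<in> {0..<box_volume d C a b}. P (cell d C (Suc n) k a b p)}"
    show "p \<in> A \<union> (+) l ` B"
    proof (cases "p < l")
      case True
      then show ?thesis using p by (auto simp: A_def Let_def l_def m_def i_def)
    next
      case False
      then have "p - l \<in> B" using p lr(3)
        by (auto simp: B_def Let_def l_def[symmetric] m_def[symmetric] i_def[symmetric]
          simp del: One_nat_def add_Suc_right)
      then show ?thesis by (force simp: image_iff)
    qed
  next
    fix p assume "p \<in> A \<union> (+) l ` B"
    then show "p \<in> {p \<in> {0..<box_volume d C a b}. P (cell d C (Suc n) k a b p)}"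
      using lr by (auto simp: A_def B_def Let_def l_def[symmetric] m_def[symmetric] i_def[symmetric]
          simp del: One_nat_def add_Suc_right)
  qed
  have shift: "(+) l ` B = (\<lambda>p. p - l) -` B"
    by (auto simp: image_iff) (metis add_diff_cancel_left' diff_add_cancel add.commute)
  have [measurable]: "(+) l ` B \<in> sets borel"
    unfolding shift using measurable_sets[of "\<lambda>p. p - l" borel borel B] by simp
  have "emeasure lborel (A \<union> (+) l ` B) = emeasure lborel A + emeasure lborel ((+) l ` B)"
  proof (rule plus_emeasure[symmetric])
    show "A \<inter> (+) l ` B = {}" by (auto simp: A_def B_def)
  qed simp_all
  moreover have "emeasure lborel ((+) l ` B) = emeasure lborel B"
  proof -
    have "emeasure lborel ((+) l ` B) = emeasure (distr lborel borel ((+) l)) ((+) l ` B)"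
      by (simp add: lborel_distr_plus)
    also have "\<dots> = emeasure lborel ((+) l -` ((+) l ` B))"
      by (subst emeasure_distr) auto
    also have "(+) l -` ((+) l ` B) = B" by (rule inj_vimage_image_eq) (simp add: inj_def)
    finally show ?thesis .
  qed
  moreover have "emeasure lborel A \<noteq> \<infinity>" "emeasure lborel B \<noteq> \<infinity>"
  proof -
    have "A \<subseteq> {0..<l}" "B \<subseteq> {0..<r}" by (auto simp: A_def B_def)
    then have "emeasure lborel A \<le> emeasure lborel {0..<l}" "emeasure lborel B \<le> emeasure lborel {0..<r}"
      by (simp_all add: emeasure_mono)
    then show "emeasure lborel A \<noteq> \<infinity>" "emeasure lborel B \<noteq> \<infinity>"
      using lr by (auto simp: top_unique)
  qed
  ultimately have "measure lborel (A \<union> (+) l ` B) = measure lborel A + measure lborel B"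
    unfolding measure_def by (simp add: enn2real_plus less_top)
  then show ?thesis
    unfolding cell_mass_def eq by (simp add: A_def B_def l_def r_def)
qed

lemma cell_mass_0:
  assumes "copula d C" "subbox d a b"
  shows "cell_mass d C 0 k a b P = (if P (a, b) then box_volume d C a b else 0)"
proof -
  have "{p \<in> {0..<box_volume d C a b}. P (cell d C 0 k a b p)} =
      (if P (a, b) then {0..<box_volume d C a b} else {})"
    by auto
  then show ?thesis using box_volume_nonneg[OF assms] by (simp add: cell_mass_def)
qed

text \<open>Comparison principle: a functional \<open>G\<close> that is additive under bisection and
  dominates the volume of each selected cell dominates their total mass. Here \<open>G\<close> will
  be \<open>clipped_volume\<close>; the next lemma is the mirror image.\<close>

lemma cell_mass_le:
  assumes C: "copula d C" and d: "0 < d" and ab: "subbox d a b"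
    and G: "\<And>a b i m. i \<in> {1..d} \<Longrightarrow> G a b = G a (b(i := m)) + G (a(i := m)) b"
    and P: "\<And>a b. subbox d a b \<Longrightarrow> (if P (a, b) then box_volume d C a b else 0) \<le> G a b"
  shows "cell_mass d C n k a b P \<le> (G a b :: real)"
  using ab
proof (induction n arbitrary: k a b)
  case 0
  then show ?case using P cell_mass_0[OF C] by simp
next
  case (Suc n)
  let ?i = "k mod d + 1"
  note i = split_index[OF d, of k]
  show ?case
    using Suc.IH[OF subbox_halves(1)[OF Suc.prems i], of "Suc k"]
      Suc.IH[OF subbox_halves(2)[OF Suc.prems i], of "Suc k"]
      G[OF i, of a b "(a ?i + b ?i) / 2"] cell_mass_Suc[OF C d Suc.prems, of n k P] by linarith
qed

lemma cell_mass_ge: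
  assumes C: "copula d C" and d: "0 < d" and ab: "subbox d a b"
    and G: "\<And>a b i m. i \<in> {1..d} \<Longrightarrow> G a b = G a (b(i := m)) + G (a(i := m)) b"
    and P: "\<And>a b. subbox d a b \<Longrightarrow> G a b \<le> (if P (a, b) then box_volume d C a b else 0)"
  shows "(G a b :: real) \<le> cell_mass d C n k a b P"
  using ab
proof (induction n arbitrary: k a b)
  case 0
  then show ?case using P cell_mass_0[OF C] by simp
next
  case (Suc n)
  let ?i = "k mod d + 1"
  note i = split_index[OF d, of k]
  show ?case
    using Suc.IH[OF subbox_halves(1)[OF Suc.prems i], of "Suc k"]
      Suc.IH[OF subbox_halves(2)[OF Suc.prems i], of "Suc k"]
      G[OF i, of a b "(a ?i + b ?i) / 2"] cell_mass_Suc[OF C d Suc.prems, of n k P] by linarith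
qed

text \<open>The \<open>C\<close>-volume of the part of the box below \<open>u\<close>. It is
  additive in the box and equals \<open>C u\<close> on the unit cube, so it carries
  \<open>C u\<close> down to single cells.\<close>

definition clipped_volume where
  "clipped_volume d C u a b = box_volume d C (\<lambda>i. min (a i) (u i)) (\<lambda>i. min (b i) (u i))"

lemma clipped_volume_split:
  assumes "i \<in> {1..d}"
  shows "clipped_volume d C u a b = clipped_volume d C u a (b(i := m)) + clipped_volume d C u (a(i := m)) b"
proof -
  have "(\<lambda>j. min ((f(i := m)) j) (u j)) = (\<lambda>j. min (f j) (u j))(i := min m (u i))" for f
    by auto
  then show ?thesis unfolding clipped_volume_def using box_volume_split[OF assms] by simp
qed

lemma subbox_clip:
  assumes "u \<in> cube d" "subbox d a b"
  shows "subbox d (\<lambda>i. min (a i) (u i)) (\<lambda>i. min (b i) (u i))"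
  using assms by (auto simp: cube_def subbox_def PiE_iff min_def)

text \<open>Clipping does not change a cell that lies entirely below \<open>u\<close>; any other
  clipped volume is still nonnegative.\<close>

lemma clipped_volume_lower:
  assumes C: "copula d C" and u: "u \<in> cube d" and ab: "subbox d a b"
  shows "(if \<forall>i\<in>{1..d}. b i \<le> u i then box_volume d C a b else 0) \<le> clipped_volume d C u a b"
proof (cases "\<forall>i\<in>{1..d}. b i \<le> u i")
  case True
  then have "clipped_volume d C u a b = box_volume d C a b"
    unfolding clipped_volume_def
  proof (intro box_volume_cong)
    fix i assume "i \<in> {1..d}"
    then have "a i \<le> b i" "b i \<le> u i" using ab True by (auto simp: subbox_def)
    then show "min (a i) (u i) = a i" "min (b i) (u i) = b i" by auto
  qed
  then show ?thesis using True by simp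
next
  case False
  then show ?thesis
    using box_volume_nonneg[OF C subbox_clip[OF u ab]] by (auto simp: clipped_volume_def)
qed

text \<open>If the lower corner exceeds \<open>u\<close> in some coordinate, the clipped box is
  degenerate there; otherwise clipping only lowers the upper corner.\<close>

lemma clipped_volume_upper:
  assumes C: "copula d C" and u: "u \<in> cube d" and ab: "subbox d a b"
  shows "clipped_volume d C u a b \<le> (if \<forall>i\<in>{1..d}. a i \<le> u i then box_volume d C a b else 0)"
proof (cases "\<forall>i\<in>{1..d}. a i \<le> u i")
  case True
  then have "clipped_volume d C u a b = box_volume d C a (\<lambda>i. min (b i) (u i))"
    unfolding clipped_volume_def by (intro box_volume_cong) auto
  also have "\<dots> \<le> box_volume d C a b"
    using True ab by (intro box_volume_mono_upper[OF C ab]) (auto simp: subbox_def)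
  finally show ?thesis using True by simp
next
  case False
  then obtain i where i: "i \<in> {1..d}" "u i < a i" by force
  then have "min (a i) (u i) = min (b i) (u i)" using ab by (force simp: subbox_def)
  then have "clipped_volume d C u a b = 0"
    unfolding clipped_volume_def by (intro box_volume_degenerate[OF i(1)])
  then show ?thesis using False by auto
qed

lemma subbox_unit: "subbox d (\<lambda>_. 0) (\<lambda>_. 1)"
  by (simp add: subbox_def)

lemma copula_one:
  assumes "copula d C" "0 < d"
  shows "C (\<lambda>i\<in>{1..d}. 1) = 1"
  using copula_marginal[OF assms(1), of "\<lambda>i\<in>{1..d}. 1" 1] assms(2) by (simp add: cube_def)

lemma box_volume_unit:
  assumes "copula d C" "0 < d"
  shows "box_volume d C (\<lambda>_. 0) (\<lambda>_. 1) = 1"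
proof -
  have "box_volume d C (\<lambda>_. 0) (\<lambda>_. 1) = box_volume d C (\<lambda>_. 0) (\<lambda>i\<in>{1..d}. 1)"
    by (rule box_volume_cong) auto
  also have "\<dots> = 1"
    using assms box_volume_zero[OF assms(1), of "\<lambda>i\<in>{1..d}. 1"] copula_one by (simp add: cube_def)
  finally show ?thesis .
qed

lemma clipped_volume_unit:
  assumes "copula d C" "u \<in> cube d"
  shows "clipped_volume d C u (\<lambda>_. 0) (\<lambda>_. 1) = C u"
proof -
  have "clipped_volume d C u (\<lambda>_. 0) (\<lambda>_. 1) = box_volume d C (\<lambda>_. 0) u"
    unfolding clipped_volume_def using assms(2) by (intro box_volume_cong) (auto simp: cube_def PiE_iff)
  then show ?thesis using box_volume_zero[OF assms] by simp
qed

text \<open>The steps \<open>d * q + r\<close> with \<open>r = i - 1\<close> and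
  \<open>q < m\<close> all bisect coordinate \<open>i\<close>, so \<open>m\<close> rounds of
  \<open>d\<close> steps shrink every side at least \<open>m\<close> times.\<close>

lemma card_residues_ge:
  assumes "i \<in> {1..d::nat}"
  shows "m \<le> card {j \<in> {0..<d * m}. j mod d + 1 = i}"
proof -
  obtain r where r: "i = r + 1" "r < d" using assms by (cases i) auto
  have "inj_on (\<lambda>q. d * q + r) {..<m}" using r by (auto simp: inj_on_def)
  moreover have "(\<lambda>q. d * q + r) ` {..<m} \<subseteq> {j \<in> {0..<d * m}. j mod d + 1 = i}"
  proof
    fix x assume "x \<in> (\<lambda>q. d * q + r) ` {..<m}"
    then obtain q where q: "q < m" "x = d * q + r" by auto
    have "x < d * Suc q" using q r by simp
    also have "\<dots> \<le> d * m" using q by (intro mult_le_mono2) auto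
    finally show "x \<in> {j \<in> {0..<d * m}. j mod d + 1 = i}" using q r by simp
  qed
  ultimately have "card {..<m} \<le> card {j \<in> {0..<d * m}. j mod d + 1 = i}"
    by (intro card_inj_on_le[where f = "\<lambda>q. d * q + r"]) auto
  then show ?thesis by simp
qed

lemma copula_measure_exists:
  assumes C: "copula d C" and d: "0 < d"
  obtains Q where "is_copula_measure d C Q"
proof -
  define lo where "lo n p = fst (cell d C n 0 (\<lambda>_. 0) (\<lambda>_. 1) p)" for n p
  define hi where "hi n p = snd (cell d C n 0 (\<lambda>_. 0) (\<lambda>_. 1) p)" for n p
  define M :: "real measure" where "M = restrict_space lborel {0..<1}"
  have spM: "space M = {0..<1}" by (simp add: M_def space_restrict_space)
  interpret prob_space M
    by (rule prob_spaceI) (simp add: M_def space_restrict_space emeasure_restrict_space)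
  have box: "subbox d (lo n p) (hi n p)"
    and lo_Suc: "i \<in> {1..d} \<Longrightarrow> lo n p i \<le> lo (Suc n) p i"
    and hi_Suc: "i \<in> {1..d} \<Longrightarrow> hi (Suc n) p i \<le> hi n p i" for n p i
    using cell_nested[OF d subbox_unit, of C n 0 p] unfolding lo_def hi_def by auto
  have lo_mono: "incseq (\<lambda>n. lo n p i)" and hi_mono: "decseq (\<lambda>n. hi n p i)" if "i \<in> {1..d}" for p i
    using lo_Suc[OF that] hi_Suc[OF that] by (auto intro: incseq_SucI decseq_SucI)
  have bounds: "0 \<le> lo n p i" "lo n p i \<le> hi n p i" "hi n p i \<le> 1" if "i \<in> {1..d}" for n p i
    using box[of n p] that unfolding subbox_def by blast+
  \<comment> \<open>The lower corners increase and are bounded, so they converge; since the widths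
    vanish, the limit is the only point common to all the closed boxes.\<close>
  define F where "F p = (\<lambda>i\<in>{1..d}. lim (\<lambda>n. lo n p i))" for p
  have lo_lim: "(\<lambda>n. lo n p i) \<longlonglongrightarrow> F p i" if i: "i \<in> {1..d}" for p i
  proof -
    have "lo n p i \<le> 1" for n using bounds[OF i, of n p] by linarith
    then have "convergent (\<lambda>n. lo n p i)"
      using incseq_convergent[OF lo_mono[OF i]] convergent_def by metis
    then show ?thesis using i by (simp add: F_def convergent_LIMSEQ_iff)
  qed
  have lo_le: "lo n p i \<le> F p i" if "i \<in> {1..d}" for n p i
    using incseq_le[OF lo_mono lo_lim] that by blast
  have le_hi: "F p i \<le> hi n p i" if i: "i \<in> {1..d}" for n p i
  proof (rule LIMSEQ_le_const2[OF lo_lim[OF i]], intro exI allI impI)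
    fix m assume "n \<le> m"
    then have "hi m p i \<le> hi n p i" using hi_mono[OF i] by (auto simp: decseq_def)
    then show "lo m p i \<le> hi n p i" using bounds(2)[OF i, of m p] by linarith
  qed
  have width: "\<exists>n. hi n p i < F p i + e" if i: "i \<in> {1..d}" and e: "0 < e" for p i e
  proof -
    \<comment> \<open>After \<open>m\<close> full rounds the side in coordinate \<open>i\<close> is
      at most \<open>(1/2) ^ m\<close>.\<close>
    obtain m where m: "(1/2) ^ m < e" using real_arch_pow_inv[OF e, of "1/2"] by auto
    let ?c = "card {j \<in> {0..<d * m}. j mod d + 1 = i}"
    have "hi (d * m) p i - lo (d * m) p i = (1/2) ^ ?c"
      unfolding lo_def hi_def cell_width by (simp add: power_one_over)
    also have "\<dots> \<le> (1/2) ^ m" using card_residues_ge[OF i, of m] by (intro power_decreasing) auto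
    finally show ?thesis using m lo_le[OF i, of "d * m" p] by (intro exI[of _ "d * m"]) linarith
  qed
  have F01: "0 \<le> F p i" "F p i \<le> 1" if "i \<in> {1..d}" for p i
    using lo_le[OF that, of 0] le_hi[OF that, of p 0] bounds[OF that, of 0 p] by (auto simp: lo_def hi_def)
  have lo_meas [measurable]: "{p \<in> space M. P (lo n p)} \<in> sets M" for P n
    using cell_measurable[of "\<lambda>x. P (fst x)" d C n 0]
    by (auto simp: M_def sets_restrict_space space_restrict_space lo_def Int_def image_iff)
  have hi_meas [measurable]: "{p \<in> space M. P (hi n p)} \<in> sets M" for P n
    using cell_measurable[of "\<lambda>x. P (snd x)" d C n 0]
    by (auto simp: M_def sets_restrict_space space_restrict_space hi_def Int_def image_iff)
  have F_meas1: "(\<lambda>p. F p i) \<in> borel_measurable M" if i: "i \<in> {1..d}" for i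
  proof (rule borel_measurable_LIMSEQ_real[OF lo_lim[OF i]])
    show "(\<lambda>p. lo n p i) \<in> borel_measurable M" for n
      by (rule borel_measurableI_le) (rule lo_meas)
  qed
  have F_cube: "F p \<in> cube d" for p using F01 by (auto simp: cube_def F_def)
  have F_meas [measurable]: "F \<in> measurable M (cube_borel d)"
    unfolding cube_borel_def
  proof (rule measurable_PiM_single')
    show "(\<lambda>p. F p i) \<in> measurable M (restrict_space borel {0..1})" if "i \<in> {1..d}" for i
      using F_meas1[OF that] F01[OF that] by (intro measurable_restrict_space2) auto
    show "F \<in> space M \<rightarrow> {1..d} \<rightarrow>\<^sub>E space (restrict_space borel {0..1})"
      using F_cube by (auto simp: cube_def space_restrict_space)
  qed
  have mass: "measure M {p \<in> space M. P (cell d C n 0 (\<lambda>_. 0) (\<lambda>_. 1) p)} =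
      cell_mass d C n 0 (\<lambda>_. 0) (\<lambda>_. 1) P" for P n
    unfolding cell_mass_def box_volume_unit[OF C d] spM unfolding M_def
    by (intro measure_restrict_space) auto
  \<comment> \<open>One half of the sandwich: cells entirely below \<open>u\<close> have total mass
    at most \<open>C u\<close> at each depth. Once below \<open>u\<close>, cells stay there, so
    continuity from below applies.\<close>
  have hi_le_C: "measure M {p \<in> space M. \<exists>n. \<forall>i\<in>{1..d}. hi n p i \<le> u i} \<le> C u" if u: "u \<in> cube d" for u
  proof -
    let ?A = "\<lambda>n. {p \<in> space M. \<forall>i\<in>{1..d}. hi n p i \<le> u i}"
    have "measure M (?A n) \<le> C u" for n
      unfolding hi_def mass[of "\<lambda>x. \<forall>i\<in>{1..d}. snd x i \<le> u i" n] clipped_volume_unit[OF C u, symmetric]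
      by (rule cell_mass_le[OF C d subbox_unit clipped_volume_split])
         (use clipped_volume_lower[OF C u] in auto)
    moreover have "incseq ?A"
      using order_trans[OF hi_Suc] by (intro incseq_SucI) blast
    then have "(\<lambda>n. measure M (?A n)) \<longlonglongrightarrow> measure M (\<Union>n. ?A n)"
      using hi_meas[of "\<lambda>x. \<forall>i\<in>{1..d}. x i \<le> u i"] by (intro finite_Lim_measure_incseq) auto
    ultimately have "measure M (\<Union>n. ?A n) \<le> C u"
      by (intro LIMSEQ_le_const2) auto
    also have "(\<Union>n. ?A n) = {p \<in> space M. \<exists>n. \<forall>i\<in>{1..d}. hi n p i \<le> u i}" by auto
    finally show ?thesis .
  qed
  \<comment> \<open>The other half: the cells with lower corner below \<open>u\<close> carry at
    least \<open>C u\<close>. These events decrease with the depth, and in the limit they say that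
    \<open>F p\<close> is below \<open>u\<close>.\<close>
  have C_le_F: "C u \<le> measure M {p \<in> space M. \<forall>i\<in>{1..d}. F p i \<le> u i}" if u: "u \<in> cube d" for u
  proof -
    let ?A = "\<lambda>n. {p \<in> space M. \<forall>i\<in>{1..d}. lo n p i \<le> u i}"
    have "C u \<le> measure M (?A n)" for n
      unfolding lo_def mass[of "\<lambda>x. \<forall>i\<in>{1..d}. fst x i \<le> u i" n] clipped_volume_unit[OF C u, symmetric]
      by (rule cell_mass_ge[OF C d subbox_unit clipped_volume_split])
         (use clipped_volume_upper[OF C u] in auto)
    moreover have "decseq ?A"
      using order_trans[OF lo_Suc] by (intro decseq_SucI) blast
    then have "(\<lambda>n. measure M (?A n)) \<longlonglongrightarrow> measure M (\<Inter>n. ?A n)"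
      using lo_meas[of "\<lambda>x. \<forall>i\<in>{1..d}. x i \<le> u i"] by (intro finite_Lim_measure_decseq) auto
    ultimately have "C u \<le> measure M (\<Inter>n. ?A n)"
      by (intro LIMSEQ_le_const) auto
    also have "(\<Inter>n. ?A n) = {p \<in> space M. \<forall>i\<in>{1..d}. F p i \<le> u i}"
    proof -
      have "(\<forall>n. lo n p i \<le> u i) \<longleftrightarrow> F p i \<le> u i" if "i \<in> {1..d}" for p i
        using lo_le[OF that] LIMSEQ_le_const2[OF lo_lim[OF that]] order_trans by metis
      then have "(\<forall>n. \<forall>i\<in>{1..d}. lo n p i \<le> u i) \<longleftrightarrow> (\<forall>i\<in>{1..d}. F p i \<le> u i)" for p by blast
      then show ?thesis by blast
    qed
    finally show ?thesis .
  qed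
  have [measurable]: "{p \<in> space M. F p i \<le> t} \<in> sets M" "{p \<in> space M. F p i < t} \<in> sets M"
    "{p \<in> space M. F p i = t} \<in> sets M" if "i \<in> {1..d}" for i t
    using F_meas1[OF that] by measurable
  \<comment> \<open>Apply both halves to corners that equal 1 except in coordinate \<open>i\<close>.
    This gives \<open>P (F i <= s) >= s\<close> and \<open>P (F i < s) <= s\<close>, so an atom at
    \<open>t\<close> has mass at most \<open>(t + e) - (t - e)\<close>.\<close>
  have F_atomless: "measure M {p \<in> space M. F p i = t} = 0" if i: "i \<in> {1..d}" and t: "0 \<le> t" "t < 1" for i t
  proof -
    define u where "u s = (\<lambda>j\<in>{1..d}. if j = i then s else 1 :: real)" for s
    have u: "u s \<in> cube d" "C (u s) = s" if "0 \<le> s" "s \<le> 1" for s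
    proof -
      show "u s \<in> cube d" using that by (auto simp: u_def cube_def)
      then show "C (u s) = s" using copula_marginal[OF C, of "u s" i] i by (auto simp: u_def)
    qed
    \<comment> \<open>Negative \<open>s\<close> are included because the bound is used at
      \<open>t - e\<close>.\<close>
    have ge: "s \<le> measure M {p \<in> space M. F p i \<le> s}" if "s \<le> 1" for s
    proof (cases "0 \<le> s")
      case True
      have "{p \<in> space M. \<forall>j\<in>{1..d}. F p j \<le> u s j} = {p \<in> space M. F p i \<le> s}"
      proof -
        have "(\<forall>j\<in>{1..d}. F p j \<le> u s j) \<longleftrightarrow> F p i \<le> s" for p
        proof
          assume "\<forall>j\<in>{1..d}. F p j \<le> u s j"
          then have "F p i \<le> u s i" using i by blast
          then show "F p i \<le> s" using i by (simp add: u_def)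
        next
          assume "F p i \<le> s"
          then show "\<forall>j\<in>{1..d}. F p j \<le> u s j" using F01(2) by (simp add: u_def)
        qed
        then show ?thesis by simp
      qed
      then show ?thesis using C_le_F[OF u(1)[OF True that]] u(2)[OF True that] by simp
    next
      case False
      then show ?thesis using measure_nonneg[of M "{p \<in> space M. F p i \<le> s}"] by linarith
    qed
    have le: "measure M {p \<in> space M. F p i < s} \<le> s" if s: "0 \<le> s" "s \<le> 1" for s
    proof -
      have "{p \<in> space M. F p i < s} \<subseteq> {p \<in> space M. \<exists>n. \<forall>j\<in>{1..d}. hi n p j \<le> u s j}"
      proof clarify
        fix p assume "F p i < s"
        then obtain n where "hi n p i < s" using width[OF i, of "s - F p i" p] by auto
        then show "\<exists>n. \<forall>j\<in>{1..d}. hi n p j \<le> u s j"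
          using bounds(3) by (intro exI[of _ n]) (auto simp: u_def)
      qed
      moreover have "{p \<in> space M. \<exists>n. \<forall>j\<in>{1..d}. hi n p j \<le> u s j} \<in> sets M"
        using hi_meas[of "\<lambda>x. \<forall>j\<in>{1..d}. x j \<le> u s j"] by measurable
      ultimately have "measure M {p \<in> space M. F p i < s} \<le>
          measure M {p \<in> space M. \<exists>n. \<forall>j\<in>{1..d}. hi n p j \<le> u s j}"
        by (rule finite_measure_mono)
      also have "\<dots> \<le> s" using hi_le_C[OF u(1)[OF s]] u(2)[OF s] by simp
      finally show ?thesis .
    qed
    let ?x = "measure M {p \<in> space M. F p i = t}"
    have small: "?x \<le> 2 * e" if e: "0 < e" "t + e \<le> 1" for e
    proof -
      have "?x + measure M {p \<in> space M. F p i \<le> t - e} =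
          measure M ({p \<in> space M. F p i = t} \<union> {p \<in> space M. F p i \<le> t - e})"
        using e i by (intro finite_measure_Union[symmetric]) auto
      also have "\<dots> \<le> measure M {p \<in> space M. F p i < t + e}"
        using e i by (intro finite_measure_mono) auto
      also have "\<dots> \<le> t + e" using e t by (intro le) auto
      finally show ?thesis using ge[of "t - e"] e t by linarith
    qed
    show ?thesis
    proof (rule ccontr)
      assume "?x \<noteq> 0"
      then have x: "0 < ?x" by (simp add: zero_less_measure_iff)
      \<comment> \<open>The first term makes \<open>2 * e\<close> smaller than the supposed atom;
        the second keeps \<open>t + e\<close> in the unit interval.\<close>
      define e where "e = min (?x / 3) (1 - t)"
      have "e \<le> ?x / 3" "e \<le> 1 - t" unfolding e_def by (rule min.cobounded1, rule min.cobounded2)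
      moreover have "0 < e" using x t by (auto simp: e_def)
      ultimately show False using small[of e] x by linarith
    qed
  qed
  have F_law: "measure M {p \<in> space M. \<forall>i\<in>{1..d}. F p i \<le> u i} = C u" if u: "u \<in> cube d" for u
  proof (rule antisym)
    let ?B = "{p \<in> space M. \<exists>n. \<forall>i\<in>{1..d}. hi n p i \<le> u i}"
    \<comment> \<open>Coordinates with \<open>u i = 1\<close> are left out: atoms have been excluded
      only below 1, and there the upper corner satisfies the bound at every depth.\<close>
    let ?I = "{i \<in> {1..d}. u i < 1}"
    let ?N = "\<Union>i\<in>?I. {p \<in> space M. F p i = u i}"
    have B [measurable]: "?B \<in> sets M"
      using hi_meas[of "\<lambda>x. \<forall>j\<in>{1..d}. x j \<le> u j"] by measurable
    have N: "?N \<in> sets M" by (intro sets.finite_UN) auto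
    have "{p \<in> space M. \<forall>i\<in>{1..d}. F p i \<le> u i} \<subseteq> ?B \<union> ?N"
    proof
      fix p assume p: "p \<in> {p \<in> space M. \<forall>i\<in>{1..d}. F p i \<le> u i}"
      show "p \<in> ?B \<union> ?N"
      proof (cases "p \<in> ?N")
        case False
        have "\<exists>n. hi n p i \<le> u i" if i: "i \<in> {1..d}" for i
        proof (cases "u i < 1")
          case True
          then have "F p i < u i" using False p i by force
          then obtain n where "hi n p i < u i" using width[OF i, of "u i - F p i" p] by auto
          then show ?thesis by (intro exI[of _ n]) simp
        next
          case False
          then show ?thesis using bounds(3)[OF i, of 0 p] by (intro exI[of _ 0]) linarith
        qed
        then obtain n where n: "\<And>i. i \<in> {1..d} \<Longrightarrow> hi (n i) p i \<le> u i" by metis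
        have "hi (Max (n ` {1..d})) p i \<le> u i" if i: "i \<in> {1..d}" for i
        proof -
          have "n i \<le> Max (n ` {1..d})" using i by auto
          then have "hi (Max (n ` {1..d})) p i \<le> hi (n i) p i"
            using hi_mono[OF i, of p] by (auto simp: decseq_def)
          then show ?thesis using n[OF i] by linarith
        qed
        then show ?thesis using p by blast
      qed simp
    qed
    then have "measure M {p \<in> space M. \<forall>i\<in>{1..d}. F p i \<le> u i} \<le> measure M (?B \<union> ?N)"
      using B N by (intro finite_measure_mono) auto
    also have "\<dots> \<le> measure M ?B + measure M ?N" by (rule measure_Un_le[OF B N])
    also have "measure M ?N \<le> (\<Sum>i\<in>?I. measure M {p \<in> space M. F p i = u i})"
      by (rule measure_UNION_le) auto
    also have "\<dots> = 0"
    proof (rule sum.neutral, rule ballI)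
      fix i assume "i \<in> ?I"
      then have "i \<in> {1..d}" "0 \<le> u i" "u i < 1" using u by (auto simp: cube_def PiE_iff)
      then show "measure M {p \<in> space M. F p i = u i} = 0" by (rule F_atomless)
    qed
    finally show "measure M {p \<in> space M. \<forall>i\<in>{1..d}. F p i \<le> u i} \<le> C u"
      using hi_le_C[OF u] by simp
  qed (rule C_le_F[OF u])
  have "is_copula_measure d C (distr M (cube_borel d) F)"
    unfolding is_copula_measure_def
  proof (intro conjI ballI)
    show "prob_space (distr M (cube_borel d) F)" by (rule prob_space_distr) measurable
    fix u assume u: "u \<in> cube d"
    have "PiE {1..d} (\<lambda>i. {0..u i}) \<in> sets (cube_borel d)"
      unfolding cube_borel_def
    proof (rule sets_PiM_I_finite)
      fix i assume "i \<in> {1..d}"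
      then have "u i \<le> 1" using u by (auto simp: cube_def PiE_iff)
      then show "{0..u i} \<in> sets (restrict_space borel {0..1})"
        by (auto simp: sets_restrict_space_iff)
    qed simp
    then have "measure (distr M (cube_borel d) F) (PiE {1..d} (\<lambda>i. {0..u i})) =
        measure M (F -` PiE {1..d} (\<lambda>i. {0..u i}) \<inter> space M)"
      by (intro measure_distr F_meas)
    also have "F -` PiE {1..d} (\<lambda>i. {0..u i}) \<inter> space M = {p \<in> space M. \<forall>i\<in>{1..d}. F p i \<le> u i}"
      unfolding cube_box_eq[OF u] using F_cube by auto
    finally show "measure (distr M (cube_borel d) F) (PiE {1..d} (\<lambda>i. {0..u i})) = C u"
      using F_law[OF u] by simp
  qed simp
  then show ?thesis by (rule that)
qed

section \<open>Marginals, atoms and measurability for the measure of a copula\<close>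

lemma is_copula_measure:
  assumes "copula d C" "0 < d"
  shows "is_copula_measure d C (copula_measure d C)"
  using copula_measure_exists[OF assms] copula_measure_eqI by metis

lemma
  assumes "is_copula_measure d C Q"
  shows is_copula_measure_prob: "prob_space Q"
    and is_copula_measure_sets: "sets Q = sets (cube_borel d)"
    and is_copula_measure_space: "space Q = cube d"
    and is_copula_measure_lower: "u \<in> cube d \<Longrightarrow> measure Q {x \<in> cube d. \<forall>i\<in>{1..d}. x i \<le> u i} = C u"
  using assms sets_eq_imp_space_eq[of Q "cube_borel d"] cube_box_eq[of u d]
  by (auto simp: is_copula_measure_def)

lemma is_copula_measure_component:
  assumes "is_copula_measure d C Q" "i \<in> {1..d}"
  shows "(\<lambda>x. x i) \<in> borel_measurable Q"
  using measurable_cube_component[OF assms(2)] is_copula_measure_sets[OF assms(1)]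
  by (simp cong: measurable_cong_sets)

lemma is_copula_measure_marginal:
  assumes C: "copula d C" and Q: "is_copula_measure d C Q" and i: "i \<in> {1..d}" and t: "0 \<le> t" "t \<le> 1"
  shows "measure Q {x \<in> cube d. x i \<le> t} = t"
proof -
  define u where "u = (\<lambda>j\<in>{1..d}. if j = i then t else 1)"
  have u: "u \<in> cube d" using t by (auto simp: u_def cube_def)
  have "(\<forall>j\<in>{1..d}. x j \<le> u j) \<longleftrightarrow> x i \<le> t" if "x \<in> cube d" for x
  proof
    assume "\<forall>j\<in>{1..d}. x j \<le> u j"
    then have "x i \<le> u i" using i by blast
    then show "x i \<le> t" using i by (simp add: u_def)
  next
    assume "x i \<le> t"
    then show "\<forall>j\<in>{1..d}. x j \<le> u j" using that by (auto simp: u_def cube_def PiE_iff)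
  qed
  then have "{x \<in> cube d. \<forall>j\<in>{1..d}. x j \<le> u j} = {x \<in> cube d. x i \<le> t}" by blast
  then have "measure Q {x \<in> cube d. x i \<le> t} = C u"
    using is_copula_measure_lower[OF Q u] by simp
  also have "C u = u i"
    using i by (intro copula_marginal[OF C u i]) (simp add: u_def)
  finally show ?thesis using i by (simp add: u_def)
qed

lemma is_copula_measure_atomless:
  assumes C: "copula d C" and Q: "is_copula_measure d C Q" and i: "i \<in> {1..d}"
  shows "measure Q {x \<in> cube d. x i = t} = 0"
proof (cases "0 \<le> t \<and> t \<le> 1")
  case True
  interpret prob_space Q by (rule is_copula_measure_prob[OF Q])
  note sp = is_copula_measure_space[OF Q, symmetric]
  note marg = is_copula_measure_marginal[OF C Q i]
  have [measurable]: "(\<lambda>x. x i) \<in> borel_measurable Q"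
    by (rule is_copula_measure_component[OF Q i])
  have le: "measure Q {x \<in> cube d. x i = t} \<le> t - s" if "0 \<le> s" "s < t" for s
  proof -
    have "measure Q {x \<in> cube d. x i = t} + measure Q {x \<in> cube d. x i \<le> s} =
        measure Q ({x \<in> cube d. x i = t} \<union> {x \<in> cube d. x i \<le> s})"
      using that unfolding sp by (intro finite_measure_Union[symmetric]) auto
    also have "\<dots> \<le> measure Q {x \<in> cube d. x i \<le> t}"
      using that unfolding sp by (intro finite_measure_mono) auto
    finally show ?thesis using marg[of s] marg[of t] True that by simp
  qed
  have "measure Q {x \<in> cube d. x i = t} \<le> measure Q {x \<in> cube d. x i \<le> t}"
    unfolding sp by (intro finite_measure_mono) auto
  then have le_t: "measure Q {x \<in> cube d. x i = t} \<le> t" using marg[of t] True by simp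
  show ?thesis
  proof (rule ccontr)
    assume "measure Q {x \<in> cube d. x i = t} \<noteq> 0"
    then have pos: "0 < measure Q {x \<in> cube d. x i = t}" by (simp add: zero_less_measure_iff)
    \<comment> \<open>Half of the supposed atom is subtracted from \<open>t\<close>;
      \<open>le_t\<close> keeps the resulting \<open>s\<close> nonnegative.\<close>
    show False
      using le[of "t - measure Q {x \<in> cube d. x i = t} / 2"] le_t pos by linarith
  qed
next
  case False
  then have "{x \<in> cube d. x i = t} = {}" using i by (auto simp: cube_def PiE_iff)
  then show ?thesis by (simp only: measure_empty)
qed

text \<open>\<open>C u\<close> is the \<open>Q\<close>-measure of the section at \<open>u\<close> of
  the set of pairs with second component below the first; section measures depend measurably on
  \<open>u\<close>.\<close>

lemma copula_measurable:
  assumes Q: "is_copula_measure d C Q"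
  shows "C \<in> borel_measurable (cube_borel d)"
proof -
  interpret prob_space Q by (rule is_copula_measure_prob[OF Q])
  let ?P = "cube_borel d \<Otimes>\<^sub>M Q"
  have sp: "space Q = cube d" by (rule is_copula_measure_space[OF Q])
  define A where "A = {z \<in> space ?P. \<forall>i\<in>{1..d}. snd z i \<le> fst z i}"
  have "A = {z \<in> space ?P. \<forall>i\<in>{1..d}. z \<in> {z \<in> space ?P. snd z i \<le> fst z i}}"
    unfolding A_def by blast
  also have "\<dots> \<in> sets ?P"
  proof (rule sets.sets_Collect_finite_All)
    fix i assume i: "i \<in> {1..d}"
    have "(\<lambda>z. fst z i) \<in> borel_measurable ?P" "(\<lambda>z. snd z i) \<in> borel_measurable ?P"
      using measurable_compose[OF measurable_fst measurable_cube_component[OF i]]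
        measurable_compose[OF measurable_snd is_copula_measure_component[OF Q i]] by auto
    then show "{z \<in> space ?P. z \<in> {z \<in> space ?P. snd z i \<le> fst z i}} \<in> sets ?P"
      by simp
  qed auto
  finally have "A \<in> sets ?P" .
  then have "(\<lambda>u. emeasure Q (Pair u -` A)) \<in> borel_measurable (cube_borel d)"
    by (rule measurable_emeasure_Pair)
  then have "(\<lambda>u. enn2real (emeasure Q (Pair u -` A))) \<in> borel_measurable (cube_borel d)"
    by measurable
  moreover have "enn2real (emeasure Q (Pair u -` A)) = C u" if "u \<in> space (cube_borel d)" for u
  proof -
    have "Pair u -` A = {x \<in> cube d. \<forall>i\<in>{1..d}. x i \<le> u i}"
      using that sp by (auto simp: A_def space_pair_measure)
    then show ?thesis
      using is_copula_measure_lower[OF Q, of u] that by (simp add: measure_def)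
  qed
  ultimately show ?thesis by (rule measurable_cong[THEN iffD1, rotated])
qed

subsection \<open>The order map\<close>

text \<open>These facts give \<open>Min\<close> and \<open>Max\<close> in \<open>order_map\<close>
  nonempty finite arguments; \<open>k >= 1\<close> is what makes each \<open>J\<close>
  nonempty.\<close>

lemma order_map_family:
  assumes "k \<in> {1..d}"
  shows "finite {J. J \<subseteq> {1..d} \<and> card J = k}" "{J. J \<subseteq> {1..d} \<and> card J = k} \<noteq> {}"
    "J \<subseteq> {1..d} \<Longrightarrow> card J = k \<Longrightarrow> finite J \<and> J \<noteq> {}"
proof -
  have "{1..k} \<in> {J. J \<subseteq> {1..d} \<and> card J = k}" using assms by auto
  then show "{J. J \<subseteq> {1..d} \<and> card J = k} \<noteq> {}" by blast
qed (use assms finite_subset in auto)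

lemma order_map_obtain:
  assumes "k \<in> {1..d}"
  obtains J where "J \<subseteq> {1..d}" "card J = k" "order_map d x k = Max (x ` J)"
proof -
  have "order_map d x k \<in> (\<lambda>J. Max (x ` J)) ` {J. J \<subseteq> {1..d} \<and> card J = k}"
    unfolding order_map_def restrict_apply'[OF assms]
  proof (rule Min_in)
    show "finite ((\<lambda>J. Max (x ` J)) ` {J. J \<subseteq> {1..d} \<and> card J = k})"
      by (rule finite_imageI[OF order_map_family(1)[OF assms]])
    show "(\<lambda>J. Max (x ` J)) ` {J. J \<subseteq> {1..d} \<and> card J = k} \<noteq> {}"
      unfolding image_is_empty by (rule order_map_family(2)[OF assms])
  qed
  then show ?thesis using that by blast
qed

lemma order_map_le_Max:
  assumes "k \<in> {1..d}" "J \<subseteq> {1..d}" "card J = k"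
  shows "order_map d x k \<le> Max (x ` J)"
  unfolding order_map_def restrict_apply'[OF assms(1)] using assms(2,3)
  by (intro Min_le finite_imageI order_map_family(1)[OF assms(1)] imageI CollectI conjI)

text \<open>The set \<open>J\<close> attaining the minimum for \<open>y\<close> is also a candidate
  for \<open>x\<close>, and its maximum there is no larger.\<close>

lemma order_map_mono:
  assumes le: "\<And>i. i \<in> {1..d} \<Longrightarrow> x i \<le> y i" and k: "k \<in> {1..d}"
  shows "order_map d x k \<le> order_map d y k"
proof -
  obtain J where J: "J \<subseteq> {1..d}" "card J = k" "order_map d y k = Max (y ` J)"
    using order_map_obtain[OF k] by blast
  have fin: "finite J" "J \<noteq> {}" using order_map_family(3)[OF k J(1,2)] by auto
  have "x j \<le> Max (y ` J)" if "j \<in> J" for j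
    using le[of j] that J(1) fin by (meson Max_ge finite_imageI image_eqI order_trans subsetD)
  then have "Max (x ` J) \<le> Max (y ` J)" using fin by simp
  then show ?thesis using order_map_le_Max[OF k J(1,2), of x] J(3) by (metis order_trans)
qed

text \<open>Each order statistic is one of the coordinates. This yields both its range and, by a
  union bound, its lack of atoms.\<close>

lemma order_map_in_image:
  assumes k: "k \<in> {1..d}"
  shows "order_map d x k \<in> x ` {1..d}"
proof -
  obtain J where J: "J \<subseteq> {1..d}" "card J = k" "order_map d x k = Max (x ` J)"
    using order_map_obtain[OF k] by blast
  then have "order_map d x k \<in> x ` J"
    using order_map_family(3)[OF k J(1,2)] by simp
  then show ?thesis using J(1) by blast
qed

lemma order_map_in_ext_space: "order_map d x \<in> ext_space d"
  by (simp add: order_map_def ext_space_def)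

lemma order_map_measurable [measurable]: "order_map d \<in> measurable (ext_borel d) (ext_borel d)"
  unfolding order_map_def[abs_def] ext_borel_def
proof (rule measurable_restrict)
  fix k assume k: "k \<in> {1..d}"
  have "(\<lambda>x. x l) \<in> borel_measurable (Pi\<^sub>M {1..d} (\<lambda>_. borel :: ereal measure))" if "l \<in> {1..d}" for l
    using that by simp
  then show "(\<lambda>x. Min ((\<lambda>J. Max (x ` J)) ` {J. J \<subseteq> {1..d} \<and> card J = k}))
      \<in> borel_measurable (Pi\<^sub>M {1..d} (\<lambda>_. borel :: ereal measure))"
    using order_map_family(1,3)[OF k]
    by (intro borel_measurable_Min borel_measurable_Max) blast+
qed

lemma sorting_permutation:
  fixes x :: "nat \<Rightarrow> 'a::linorder"
  obtains \<rho> where "\<rho> permutes {1..d}" "\<And>i j. 1 \<le> i \<Longrightarrow> i \<le> j \<Longrightarrow> j \<le> d \<Longrightarrow> x (\<rho> i) \<le> x (\<rho> j)"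
proof -
  define ys where "ys = sort_key x [1..<Suc d]"
  have ys: "length ys = d" "set ys = {1..d}" "distinct ys" "sorted (map x ys)"
    by (auto simp: ys_def)
  \<comment> \<open>List positions start at 0, coordinates at 1.\<close>
  define \<rho> where "\<rho> i = (if i \<in> {1..d} then ys ! (i - 1) else i)" for i
  have "bij_betw (\<lambda>i. ys ! i) {..<d} {1..d}"
    using bij_betw_nth[OF ys(3), of "{..<d}" "{1..d}"] ys by simp
  moreover have "bij_betw (\<lambda>i. i - 1) {1..d} {..<d}"
    by (rule bij_betw_byWitness[where f' = Suc]) auto
  ultimately have "bij_betw ((\<lambda>i. ys ! i) \<circ> (\<lambda>i. i - 1)) {1..d} {1..d}"
    by (rule bij_betw_trans[rotated])
  then have "bij_betw \<rho> {1..d} {1..d}"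
    by (rule bij_betw_cong[THEN iffD1, rotated]) (auto simp: \<rho>_def)
  then have "\<rho> permutes {1..d}"
    by (rule bij_imp_permutes) (auto simp: \<rho>_def)
  moreover have "x (\<rho> i) \<le> x (\<rho> j)" if "1 \<le> i" "i \<le> j" "j \<le> d" for i j
    using sorted_nth_mono[OF ys(4), of "i - 1" "j - 1"] that ys(1) by (auto simp: \<rho>_def)
  ultimately show ?thesis by (rule that)
qed

text \<open>For the upper bound take the positions of the \<open>k\<close> smallest entries as
  \<open>J\<close>. Conversely, by counting, any \<open>J\<close> of size \<open>k\<close> contains
  some \<open>\<rho> l\<close> with \<open>l >= k\<close>.\<close>

lemma order_map_sorting_permutation:
  assumes \<rho>: "\<rho> permutes {1..d}" and sorted: "\<And>i j. 1 \<le> i \<Longrightarrow> i \<le> j \<Longrightarrow> j \<le> d \<Longrightarrow> x (\<rho> i) \<le> x (\<rho> j)"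
    and k: "k \<in> {1..d}"
  shows "order_map d x k = x (\<rho> k)"
proof (rule antisym)
  have inj: "inj_on \<rho> A" for A by (rule permutes_inj_on[OF \<rho>])
  have img: "\<rho> ` {1..k} \<subseteq> {1..d}"
    using image_mono[of "{1..k}" "{1..d}" \<rho>] permutes_image[OF \<rho>] k by auto
  have "order_map d x k \<le> Max (x ` (\<rho> ` {1..k}))"
    using card_image[OF inj, of "{1..k}"] by (intro order_map_le_Max[OF k img]) simp
  also have "\<dots> \<le> x (\<rho> k)"
    using k sorted by (subst Max_le_iff) auto
  finally show "order_map d x k \<le> x (\<rho> k)" .
  obtain J where J: "J \<subseteq> {1..d}" "card J = k" "order_map d x k = Max (x ` J)"
    using order_map_obtain[OF k] by blast
  have "\<not> J \<subseteq> \<rho> ` {1..<k}"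
  proof
    assume "J \<subseteq> \<rho> ` {1..<k}"
    then have "card J \<le> card (\<rho> ` {1..<k})" by (intro card_mono) auto
    then show False using J(2) k card_image[OF inj, of "{1..<k}"] by auto
  qed
  then obtain j where j: "j \<in> J" "j \<notin> \<rho> ` {1..<k}" by blast
  then obtain l where l: "l \<in> {1..d}" "j = \<rho> l"
    using J(1) permutes_image[OF \<rho>] by (metis imageE subsetD)
  then have "k \<le> l" using j(2) by (metis atLeastAtMost_iff atLeastLessThan_iff image_eqI not_le)
  then have "x (\<rho> k) \<le> x j" using l k sorted by auto
  also have "x j \<le> Max (x ` J)" using j(1) order_map_family(3)[OF k J(1,2)] by simp
  finally show "x (\<rho> k) \<le> order_map d x k" using J(3) by simp
qed

text \<open>Match positions of equal rank: \<open>inv \<rho>\<close> finds the rank of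
  \<open>i\<close> in \<open>x\<close>, and \<open>\<pi>\<close> the position of that rank in
  \<open>y\<close>.\<close>

lemma order_map_le_imp_permuted_le:
  assumes "\<And>k. k \<in> {1..d} \<Longrightarrow> order_map d x k \<le> order_map d y k"
  obtains \<sigma> where "\<sigma> permutes {1..d}" "\<And>i. i \<in> {1..d} \<Longrightarrow> x i \<le> y (\<sigma> i)"
proof -
  obtain \<rho> where \<rho>: "\<rho> permutes {1..d}" "\<And>i j. 1 \<le> i \<Longrightarrow> i \<le> j \<Longrightarrow> j \<le> d \<Longrightarrow> x (\<rho> i) \<le> x (\<rho> j)"
    using sorting_permutation[where x = x] by blast
  obtain \<pi> where \<pi>: "\<pi> permutes {1..d}" "\<And>i j. 1 \<le> i \<Longrightarrow> i \<le> j \<Longrightarrow> j \<le> d \<Longrightarrow> y (\<pi> i) \<le> y (\<pi> j)"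
    using sorting_permutation[where x = y] by blast
  show ?thesis
  proof (rule that)
    show "\<pi> \<circ> inv \<rho> permutes {1..d}"
      using permutes_compose[OF permutes_inv[OF \<rho>(1)] \<pi>(1)] .
    fix i assume i: "i \<in> {1..d}"
    then have k: "inv \<rho> i \<in> {1..d}" using permutes_in_image[OF permutes_inv[OF \<rho>(1)]] by simp
    have "x i = x (\<rho> (inv \<rho> i))" using permutes_inverses(1)[OF \<rho>(1)] by simp
    also have "\<dots> \<le> y (\<pi> (inv \<rho> i))"
      using assms[OF k] order_map_sorting_permutation[of \<rho> d x, OF \<rho> k]
        order_map_sorting_permutation[of \<pi> d y, OF \<pi> k] by simp
    finally show "x i \<le> y ((\<pi> \<circ> inv \<rho>) i)" by simp
  qed
qed

subsection \<open>The order transform\<close>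

definition embed :: "nat \<Rightarrow> (nat \<Rightarrow> real) \<Rightarrow> nat \<Rightarrow> ereal" where
  "embed d u = (\<lambda>i\<in>{1..d}. ereal (u i))"

definition order_stat :: "nat \<Rightarrow> (nat \<Rightarrow> real) \<Rightarrow> nat \<Rightarrow> ereal" where
  "order_stat d u = order_map d (embed d u)"

lemma embed_measurable: "embed d \<in> measurable (cube_borel d) (ext_borel d)"
  unfolding embed_def[abs_def] ext_borel_def
proof (rule measurable_restrict)
  fix i assume "i \<in> {1..d}"
  from measurable_cube_component[OF this]
  show "(\<lambda>u. ereal (u i)) \<in> borel_measurable (cube_borel d)" by simp
qed

lemma order_stat_measurable: "order_stat d \<in> measurable (cube_borel d) (ext_borel d)"
  unfolding order_stat_def[abs_def]
  using measurable_compose[OF embed_measurable order_map_measurable] by simp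

lemma order_stat_in_ext_space: "order_stat d u \<in> ext_space d"
  by (simp add: order_stat_def order_map_in_ext_space)

lemma order_stat_component_measurable:
  assumes "k \<in> {1..d}"
  shows "(\<lambda>u. order_stat d u k) \<in> borel_measurable (cube_borel d)"
  using measurable_compose[OF order_stat_measurable[unfolded ext_borel_def]
      measurable_component_singleton[OF assms]] .

lemma order_stat_value:
  assumes "k \<in> {1..d}"
  obtains i where "i \<in> {1..d}" "order_stat d u k = ereal (u i)"
  using order_map_in_image[OF assms, of "embed d u"] that by (auto simp: order_stat_def embed_def)

text \<open>The condition \<open>0 <= y\<close> matters: a negative \<open>y\<close> is clamped to
  0, and the equivalence would fail at \<open>t = 0\<close>.\<close>

lemma ereal_le_iff_clamp:
  assumes "0 \<le> t" "t \<le> 1" "0 \<le> y"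
  shows "ereal t \<le> y \<longleftrightarrow> t \<le> real_of_ereal (max 0 (min y 1))"
  using assms by (cases y) (auto simp: min_def max_def one_ereal_def zero_ereal_def)

lemma df_measure_extend_df:
  assumes C: "copula d C" and Q: "is_copula_measure d C Q"
  shows "df_measure d (extend_df d C) = distr Q (ext_borel d) (embed d)"
proof (rule df_measure_eqI)
  interpret prob_space Q by (rule is_copula_measure_prob[OF Q])
  have meas: "embed d \<in> measurable Q (ext_borel d)"
    using embed_measurable is_copula_measure_sets[OF Q] by (simp cong: measurable_cong_sets)
  then show "prob_space (distr Q (ext_borel d) (embed d))" by (rule prob_space_distr)
  show "sets (distr Q (ext_borel d) (embed d)) = sets (ext_borel d)" by simp
  fix x assume x: "x \<in> ext_space d"
  define w where "w = (\<lambda>i\<in>{1..d}. real_of_ereal (max 0 (min (x i) 1)))"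
  have "0 \<le> real_of_ereal (max 0 (min y 1)) \<and> real_of_ereal (max 0 (min y 1)) \<le> 1" for y
    by (cases y) (auto simp: min_def max_def one_ereal_def zero_ereal_def)
  then have w: "w \<in> cube d" by (simp add: w_def cube_def)
  have "PiE {1..d} (\<lambda>i. {..x i}) \<in> sets (ext_borel d)"
    unfolding ext_borel_def by (rule sets_PiM_I_finite) auto
  then have "measure (distr Q (ext_borel d) (embed d)) (PiE {1..d} (\<lambda>i. {..x i})) =
      measure Q (embed d -` PiE {1..d} (\<lambda>i. {..x i}) \<inter> space Q)"
    by (rule measure_distr[OF meas])
  also have "embed d -` PiE {1..d} (\<lambda>i. {..x i}) \<inter> space Q = {u \<in> cube d. \<forall>i\<in>{1..d}. ereal (u i) \<le> x i}"
    unfolding is_copula_measure_space[OF Q] by (auto simp: embed_def PiE_iff)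
  also have "measure Q \<dots> = C w"
  proof (cases "\<forall>i\<in>{1..d}. 0 \<le> x i")
    case True
    have "ereal (u i) \<le> x i \<longleftrightarrow> u i \<le> w i" if "u \<in> cube d" "i \<in> {1..d}" for u i
      using ereal_le_iff_clamp[of "u i" "x i"] that True by (auto simp: cube_def PiE_iff w_def)
    then have "{u \<in> cube d. \<forall>i\<in>{1..d}. ereal (u i) \<le> x i} = {u \<in> cube d. \<forall>i\<in>{1..d}. u i \<le> w i}"
      by blast
    then show ?thesis using is_copula_measure_lower[OF Q w] by simp
  next
    \<comment> \<open>With a negative coordinate both sides vanish: no cube point lies below
      \<open>x\<close>, and clamping gives a zero coordinate at which \<open>C\<close> is
      grounded.\<close>
    case False
    then obtain i where i: "i \<in> {1..d}" "x i < 0" by force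
    have "\<not> ereal (u i) \<le> x i" if "u \<in> cube d" for u
    proof -
      have "0 \<le> ereal (u i)" using that i(1) by (auto simp: cube_def PiE_iff)
      then show ?thesis using i(2) by (metis leD less_le_trans)
    qed
    then have "{u \<in> cube d. \<forall>i\<in>{1..d}. ereal (u i) \<le> x i} = {}" using i(1) by blast
    moreover have "max 0 (min (x i) 1) = 0"
      using i(2) by (metis less_imp_le max.absorb1 min.coboundedI1)
    then have "w i = 0" using i(1) by (simp add: w_def)
    then have "C w = 0" by (rule copula_grounded[OF C w i(1)])
    ultimately show ?thesis by (simp only: measure_empty)
  qed
  finally show "measure (distr Q (ext_borel d) (embed d)) (PiE {1..d} (\<lambda>i. {..x i})) = extend_df d C x"
    by (simp only: extend_df_def w_def)
qed

lemma order_df_eq: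
  assumes C: "copula d C" and Q: "is_copula_measure d C Q"
  shows "order_df d C x = measure Q {u \<in> cube d. \<forall>i\<in>{1..d}. order_stat d u i \<le> x i}"
proof -
  have emb: "embed d \<in> measurable Q (ext_borel d)"
    using embed_measurable is_copula_measure_sets[OF Q] by (simp cong: measurable_cong_sets)
  have meas: "order_stat d \<in> measurable Q (ext_borel d)"
    using order_stat_measurable is_copula_measure_sets[OF Q] by (simp cong: measurable_cong_sets)
  have "distr (df_measure d (extend_df d C)) (ext_borel d) (order_map d) =
      distr Q (ext_borel d) (order_stat d)"
    unfolding df_measure_extend_df[OF C Q] distr_distr[OF order_map_measurable emb]
    by (simp add: order_stat_def[abs_def] comp_def)
  moreover have "PiE {1..d} (\<lambda>i. {..x i}) \<in> sets (ext_borel d)"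
    unfolding ext_borel_def by (rule sets_PiM_I_finite) auto
  ultimately have "order_df d C x = measure Q (order_stat d -` PiE {1..d} (\<lambda>i. {..x i}) \<inter> space Q)"
    unfolding order_df_def df_of_def by (simp add: measure_distr[OF meas])
  also have "order_stat d -` PiE {1..d} (\<lambda>i. {..x i}) \<inter> space Q =
      {u \<in> cube d. \<forall>i\<in>{1..d}. order_stat d u i \<le> x i}"
    unfolding is_copula_measure_space[OF Q]
    using order_stat_in_ext_space[of d] by (auto simp: ext_space_def PiE_iff)
  finally show ?thesis .
qed

lemma marginal_order_df_eq:
  assumes C: "copula d C" and Q: "is_copula_measure d C Q" and k: "k \<in> {1..d}"
  shows "marginal_df d (order_df d C) k t = measure Q {u \<in> cube d. order_stat d u k \<le> t}"
proof -
  have "(\<forall>i\<in>{1..d}. order_stat d u i \<le> (\<lambda>j\<in>{1..d}. if j = k then t else \<infinity>) i) \<longleftrightarrow>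
      order_stat d u k \<le> t" for u
    using k by auto
  then show ?thesis unfolding marginal_df_def order_df_eq[OF C Q] by presburger
qed

text \<open>\<open>q\<close> is the largest point of level \<open>v\<close>. The equivalence turns
  sublevel sets of \<open>G\<close> into half-lines, which later gives measurability, uniform
  marginals and control of flat parts.\<close>

lemma continuous_quantile_exists:
  fixes X :: "'a \<Rightarrow> real"
  assumes Q: "prob_space Q" and X: "X \<in> borel_measurable Q"
    and X01: "\<And>x. x \<in> space Q \<Longrightarrow> 0 \<le> X x \<and> X x \<le> 1"
    and atomless: "\<And>t. measure Q {x \<in> space Q. X x = t} = 0"
    and v: "0 \<le> v" "v \<le> 1"
  defines "G \<equiv> \<lambda>y. measure Q {x \<in> space Q. ereal (X x) \<le> y}"
  obtains q where "G q = v" "\<And>y. G y \<le> v \<longleftrightarrow> y \<le> q"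
proof (cases "v = 1")
  case True
  interpret prob_space Q by fact
  show ?thesis
  proof (rule that)
    \<comment> \<open>At level 1 there is no largest real point, since \<open>G\<close> equals 1
      from 1 onwards; \<open>\<infinity>\<close> takes its place.\<close>
    show "G \<infinity> = v" using True prob_space by (simp add: G_def)
    show "G y \<le> v \<longleftrightarrow> y \<le> \<infinity>" for y using True by (simp add: G_def)
  qed
next
  case False
  interpret prob_space Q by fact
  have G_mono: "G y \<le> G z" if "y \<le> z" for y z
    unfolding G_def using X that by (intro finite_measure_mono) (auto intro: order_trans)
  define N where "N = distr Q borel X"
  interpret N: prob_space N unfolding N_def using X by (rule prob_space_distr)
  interpret N: real_distribution N
    by unfold_locales (simp_all add: N_def)
  have cdf: "cdf N t = G (ereal t)" for t
    unfolding cdf_def N_def G_def using X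
    by (subst measure_distr) (auto intro!: arg_cong[where f = "measure Q"])
  have "measure N {t} = 0" for t
    unfolding N_def using X atomless[of t]
    by (subst measure_distr) (auto simp: vimage_def Int_def conj_commute)
  then have cont: "isCont (cdf N) t" for t using N.isCont_cdf by simp
  have "{x \<in> space Q. ereal (X x) \<le> 0} \<subseteq> {x \<in> space Q. X x = 0}" using X01 by force
  then have "G 0 \<le> measure Q {x \<in> space Q. X x = 0}"
    unfolding G_def using X by (intro finite_measure_mono) auto
  then have G0: "G 0 = 0" using atomless[of 0] by (simp add: G_def measure_le_0_iff)
  have G_ge1: "G y = 1" if "1 \<le> y" for y
  proof -
    have "{x \<in> space Q. ereal (X x) \<le> y} = space Q"
      using X01 that by (auto intro: order_trans[of _ 1])
    then show ?thesis by (simp add: G_def prob_space)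
  qed
  have "\<exists>t\<ge>0. t \<le> 1 \<and> cdf N t = v"
  proof (intro IVT allI impI)
    show "cdf N 0 \<le> v" "v \<le> cdf N 1" using v G0 G_ge1[of 1] by (simp_all add: cdf zero_ereal_def one_ereal_def)
  qed (simp_all add: cont)
  then obtain t where t: "0 \<le> t" "t \<le> 1" "cdf N t = v" by blast
  \<comment> \<open>The intermediate value theorem only supplies some point of level
    \<open>v\<close>; compactness of this sublevel set supplies the largest, and monotonicity shows
    that its level is \<open>v\<close> too.\<close>
  let ?S = "{s \<in> {0..1}. cdf N s \<le> v}"
  have "closed (cdf N -` {..v})"
    using cont by (intro continuous_closed_vimage) auto
  then have "compact ({0..1} \<inter> cdf N -` {..v})" by (intro compact_Int_closed) auto
  also have "{0..1} \<inter> cdf N -` {..v} = ?S" by auto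
  finally have "compact ?S" .
  moreover have "t \<in> ?S" using t by simp
  ultimately obtain q where q: "q \<in> ?S" "\<And>s. s \<in> ?S \<Longrightarrow> s \<le> q"
    using compact_attains_sup[of ?S] by blast
  have "t \<le> q" using q(2) \<open>t \<in> ?S\<close> by blast
  then have "v \<le> G (ereal q)" using t(3) cdf G_mono[of "ereal t" "ereal q"] by simp
  then have Gq: "G (ereal q) = v" using q(1) cdf by auto
  show ?thesis
  proof (rule that[OF Gq])
    fix y
    show "G y \<le> v \<longleftrightarrow> y \<le> ereal q"
    proof
      assume "y \<le> ereal q"
      then show "G y \<le> v" using G_mono Gq by metis
    next
      assume le: "G y \<le> v"
      show "y \<le> ereal q"
      proof (cases y)
        case (real s)
        have "s < 1" using G_ge1[of y] le False v real by (cases "s < 1") auto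
        show ?thesis
        proof (cases "0 \<le> s")
          case True
          then have "s \<in> ?S" using \<open>s < 1\<close> le real cdf by simp
          then show ?thesis using q(2) real by simp
        next
          case False
          then show ?thesis using q(1) real by auto
        qed
      next
        case PInf
        then show ?thesis using G_ge1[of y] le False v by simp
      qed simp
    qed
  qed
qed

lemma order_stat_quantile:
  assumes C: "copula d C" and Q: "is_copula_measure d C Q" and k: "k \<in> {1..d}" and v: "0 \<le> v" "v \<le> 1"
  obtains q where "marginal_df d (order_df d C) k q = v"
    "\<And>y. marginal_df d (order_df d C) k y \<le> v \<longleftrightarrow> y \<le> q"
proof -
  interpret prob_space Q by (rule is_copula_measure_prob[OF Q])
  have sp: "space Q = cube d" by (rule is_copula_measure_space[OF Q])
  define X where "X u = real_of_ereal (order_stat d u k)" for u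
  have stat: "order_stat d u k = ereal (X u)" for u
    using order_stat_value[OF k, of u] by (metis X_def real_of_ereal.simps(1))
  have "(\<lambda>u. order_stat d u k) \<in> borel_measurable Q"
    using order_stat_component_measurable[OF k] is_copula_measure_sets[OF Q]
    by (simp cong: measurable_cong_sets)
  then have X: "X \<in> borel_measurable Q" unfolding X_def[abs_def] by measurable
  have X01: "0 \<le> X u \<and> X u \<le> 1" if "u \<in> space Q" for u
    using order_stat_value[OF k, of u] that sp stat[of u]
    by (metis (no_types, lifting) PiE_E atLeastAtMost_iff cube_def ereal.inject)
  have atomless: "measure Q {u \<in> space Q. X u = t} = 0" for t
  proof -
    have "{u \<in> space Q. X u = t} \<subseteq> (\<Union>i\<in>{1..d}. {u \<in> cube d. u i = t})"
    proof
      fix u assume "u \<in> {u \<in> space Q. X u = t}"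
      moreover obtain i where "i \<in> {1..d}" "order_stat d u k = ereal (u i)"
        using order_stat_value[OF k] by blast
      ultimately show "u \<in> (\<Union>i\<in>{1..d}. {u \<in> cube d. u i = t})"
        using stat[of u] sp by auto
    qed
    moreover have sets: "{u \<in> cube d. u i = t} \<in> sets Q" if "i \<in> {1..d}" for i
      using is_copula_measure_component[OF Q that] unfolding sp[symmetric] by measurable
    ultimately have "measure Q {u \<in> space Q. X u = t} \<le> measure Q (\<Union>i\<in>{1..d}. {u \<in> cube d. u i = t})"
      by (intro finite_measure_mono sets.finite_UN) auto
    also have "\<dots> \<le> (\<Sum>i\<in>{1..d}. measure Q {u \<in> cube d. u i = t})"
      using sets by (intro measure_UNION_le) auto
    also have "\<dots> = 0"
      using is_copula_measure_atomless[OF C Q] by (intro sum.neutral) blast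
    finally show ?thesis by (simp add: measure_le_0_iff)
  qed
  have eq: "marginal_df d (order_df d C) k y = measure Q {u \<in> space Q. ereal (X u) \<le> y}" for y
    unfolding marginal_order_df_eq[OF C Q k] sp stat ..
  show ?thesis
    using continuous_quantile_exists[OF prob_space_axioms X X01 atomless v] that unfolding eq by blast
qed

lemma lower_orthant_sets: "{x \<in> cube d. \<forall>i\<in>{1..d}. x i \<le> w i} \<in> sets (cube_borel d)"
  unfolding space_cube_borel[symmetric]
proof (rule sets.sets_Collect_finite_All)
  fix i assume "i \<in> {1..d}"
  from measurable_cube_component[OF this]
  show "{x \<in> space (cube_borel d). x i \<le> w i} \<in> sets (cube_borel d)" by measurable
qed simp

text \<open>The probability integral transform: \<open>\<Phi>\<close> applies each marginal to its
  order statistic, making the marginals uniform, and the law of the result determines a copula. The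
  factorization identifies it with \<open>order_transform\<close>.\<close>

lemma order_transform_props:
  assumes C: "copula d C" and Q: "is_copula_measure d C Q"
  defines "\<Phi> \<equiv> \<lambda>x. \<lambda>i\<in>{1..d}. marginal_df d (order_df d C) i (x i)"
  shows "copula d (order_transform d C)"
    and "is_copula_measure d (order_transform d C) (distr Q (cube_borel d) (\<lambda>u. \<Phi> (order_stat d u)))"
    and "\<And>x. x \<in> ext_space d \<Longrightarrow> order_transform d C (\<Phi> x) = order_df d C x"
    and "(\<lambda>u. \<Phi> (order_stat d u)) \<in> measurable Q (cube_borel d)"
proof -
  interpret prob_space Q by (rule is_copula_measure_prob[OF Q])
  have sp: "space Q = cube d" by (rule is_copula_measure_space[OF Q])
  define m where "m i = marginal_df d (order_df d C) i" for i
  define S where "S u i = order_stat d u i" for u i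
  have \<Phi>: "\<Phi> x = (\<lambda>i\<in>{1..d}. m i (x i))" for x by (simp add: \<Phi>_def m_def)
  have m_eq: "m i t = measure Q {u \<in> space Q. S u i \<le> t}" if "i \<in> {1..d}" for i t
    unfolding m_def S_def sp using marginal_order_df_eq[OF C Q that] .
  have S_meas [measurable]: "(\<lambda>u. S u i) \<in> borel_measurable Q" if "i \<in> {1..d}" for i
    unfolding S_def using order_stat_component_measurable[OF that] is_copula_measure_sets[OF Q]
    by (simp cong: measurable_cong_sets)
  have m01: "m i t \<in> {0..1}" if "i \<in> {1..d}" for i t
    using that by (simp add: m_eq)
  have quant: "\<exists>q. m i q = v \<and> (\<forall>y. m i y \<le> v \<longleftrightarrow> y \<le> q)" if "i \<in> {1..d}" "v \<in> {0..1}" for i v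
    using order_stat_quantile[OF C Q that(1), of v] that(2) unfolding m_def by (metis atLeastAtMost_iff)
  have \<Phi>_cube: "\<Phi> x \<in> cube d" for x
    using m01 by (simp add: \<Phi> cube_def PiE_iff)
  show \<Phi>_meas: "(\<lambda>u. \<Phi> (order_stat d u)) \<in> measurable Q (cube_borel d)"
    unfolding \<Phi> cube_borel_def
  proof (rule measurable_restrict)
    fix i assume i: "i \<in> {1..d}"
    \<comment> \<open>By the quantile equivalence, sublevel sets of \<open>m i\<close> are
      half-lines.\<close>
    have "(\<lambda>u. m i (S u i)) \<in> borel_measurable Q"
    proof (rule borel_measurableI_le)
      fix a :: real
      consider "a < 0" | "a \<in> {0..1}" | "1 < a" by fastforce
      then show "{u \<in> space Q. m i (S u i) \<le> a} \<in> sets Q"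
      proof cases
        case 1
        then have "\<not> m i y \<le> a" for y using m01[OF i, of y] by auto
        then show ?thesis by simp
      next
        case 2
        then obtain q where "\<And>y. m i y \<le> a \<longleftrightarrow> y \<le> q" using quant[OF i] by blast
        then show ?thesis using S_meas[OF i] by simp
      next
        case 3
        then have "m i y \<le> a" for y using m01[OF i, of y] by auto
        then show ?thesis by simp
      qed
    qed
    then show "(\<lambda>u. m i (order_stat d u i)) \<in> measurable Q (restrict_space borel {0..1})"
      using m01[OF i] unfolding S_def by (intro measurable_restrict_space2) auto
  qed
  define R where "R = distr Q (cube_borel d) (\<lambda>u. \<Phi> (order_stat d u))"
  have R: "prob_space R" "sets R = sets (cube_borel d)"
    unfolding R_def using prob_space_distr[OF \<Phi>_meas] by auto
  have R_eq: "measure R {x \<in> cube d. P x} = measure Q {u \<in> space Q. P (\<Phi> (order_stat d u))}"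
    if "{x \<in> cube d. P x} \<in> sets (cube_borel d)" for P
  proof -
    have "(\<lambda>u. \<Phi> (order_stat d u)) -` {x \<in> cube d. P x} \<inter> space Q = {u \<in> space Q. P (\<Phi> (order_stat d u))}"
      using \<Phi>_cube by auto
    then show ?thesis unfolding R_def using measure_distr[OF \<Phi>_meas that] by simp
  qed
  have marg: "measure R {x \<in> cube d. x i \<le> t} = t" if i: "i \<in> {1..d}" and t: "0 \<le> t" "t \<le> 1" for i t
  proof -
    obtain q where q: "m i q = t" "\<And>y. m i y \<le> t \<longleftrightarrow> y \<le> q" using quant[OF i, of t] t by auto
    have "{x \<in> cube d. x i \<le> t} \<in> sets (cube_borel d)"
      using measurable_cube_component[OF i] unfolding space_cube_borel[symmetric] by measurable
    then have "measure R {x \<in> cube d. x i \<le> t} = measure Q {u \<in> space Q. \<Phi> (order_stat d u) i \<le> t}"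
      by (rule R_eq)
    also have "\<dots> = measure Q {u \<in> space Q. S u i \<le> q}"
      using i q(2) by (simp add: \<Phi> S_def)
    also have "\<dots> = t" using m_eq[OF i] q(1) by simp
    finally show ?thesis .
  qed
  define D where "D = (\<lambda>u\<in>cube d. measure R (PiE {1..d} (\<lambda>i. {0..u i})))"
  have D: "copula d D" "is_copula_measure d D R"
    unfolding D_def by (rule copula_of_measure[OF R marg]; assumption)+
  have D_\<Phi>: "D (\<Phi> x) = order_df d C x" for x
  proof -
    note box = lower_orthant_sets[of d "\<Phi> x"]
    \<comment> \<open>The left side may be weaker where the marginal is flat to the right of
      \<open>x i\<close>: it says only \<open>S u i <= q\<close>, with \<open>q\<close> the largest
      point of the same level. The strip between \<open>x i\<close> and \<open>q\<close> has mass
      \<open>m i q - m i (x i) = 0\<close>.\<close>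
    have "AE u in Q. \<forall>i\<in>{1..d}. \<Phi> (order_stat d u) i \<le> \<Phi> x i \<longleftrightarrow> S u i \<le> x i"
    proof (rule AE_finite_allI)
      fix i assume i: "i \<in> {1..d}"
      obtain q where q: "m i q = m i (x i)" "\<And>y. m i y \<le> m i (x i) \<longleftrightarrow> y \<le> q"
        using quant[OF i m01[OF i]] by blast
      have xq: "x i \<le> q" using q(2)[of "x i"] by simp
      have sets: "{u \<in> space Q. S u i \<le> q} \<in> sets Q" "{u \<in> space Q. S u i \<le> x i} \<in> sets Q"
        using S_meas[OF i] by measurable
      have "measure Q ({u \<in> space Q. S u i \<le> q} - {u \<in> space Q. S u i \<le> x i}) = m i q - m i (x i)"
        unfolding m_eq[OF i] using sets xq by (intro finite_measure_Diff) (auto intro: order_trans)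
      then have "{u \<in> space Q. S u i \<le> q} - {u \<in> space Q. S u i \<le> x i} \<in> null_sets Q"
        using sets q(1) by (intro null_setsI) (auto simp: emeasure_eq_measure)
      then have "AE u in Q. u \<notin> {u \<in> space Q. S u i \<le> q} - {u \<in> space Q. S u i \<le> x i}"
        by (rule AE_not_in)
      then show "AE u in Q. \<Phi> (order_stat d u) i \<le> \<Phi> x i \<longleftrightarrow> S u i \<le> x i"
        using AE_space
      proof eventually_elim
        case (elim u)
        then show ?case using i q(2) xq by (auto simp: \<Phi> S_def intro: order_trans)
      qed
    qed simp
    then have AE: "AE u in Q. (\<forall>i\<in>{1..d}. \<Phi> (order_stat d u) i \<le> \<Phi> x i) \<longleftrightarrow> (\<forall>i\<in>{1..d}. S u i \<le> x i)"
      by eventually_elim blast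
    have sets1: "{u \<in> space Q. \<forall>i\<in>{1..d}. \<Phi> (order_stat d u) i \<le> \<Phi> x i} \<in> sets Q"
      using measurable_sets[OF \<Phi>_meas box] \<Phi>_cube by (simp add: vimage_def Int_def conj_commute)
    have sets2: "{u \<in> space Q. \<forall>i\<in>{1..d}. S u i \<le> x i} \<in> sets Q"
      using S_meas by (intro sets.sets_Collect_finite_All) simp_all
    have "D (\<Phi> x) = measure R {y \<in> cube d. \<forall>i\<in>{1..d}. y i \<le> \<Phi> x i}"
      using is_copula_measure_lower[OF D(2) \<Phi>_cube] by simp
    also have "\<dots> = measure Q {u \<in> space Q. \<forall>i\<in>{1..d}. \<Phi> (order_stat d u) i \<le> \<Phi> x i}"
      by (rule R_eq[OF box])
    also have "\<dots> = measure Q {u \<in> space Q. \<forall>i\<in>{1..d}. S u i \<le> x i}"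
      using AE sets1 sets2 by (intro finite_measure_eq_AE) auto
    also have "\<dots> = order_df d C x"
      unfolding order_df_eq[OF C Q] sp S_def ..
    finally show ?thesis .
  qed
  have "order_transform d C = D"
    unfolding order_transform_def
  proof (rule the_equality)
    show "copula d D \<and> (\<forall>x\<in>ext_space d. order_df d C x = D (\<lambda>i\<in>{1..d}. marginal_df d (order_df d C) i (x i)))"
      using D(1) D_\<Phi> by (simp add: \<Phi>_def)
  next
    fix D' assume D': "copula d D' \<and>
      (\<forall>x\<in>ext_space d. order_df d C x = D' (\<lambda>i\<in>{1..d}. marginal_df d (order_df d C) i (x i)))"
    show "D' = D"
    proof (rule extensionalityI)
      show "D' \<in> extensional (cube d)" "D \<in> extensional (cube d)"
        using D' D(1) by (simp_all add: copula_def PiE_iff)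
      fix u assume u: "u \<in> cube d"
      \<comment> \<open>Quantiles make \<open>\<Phi>\<close> surjective onto the cube, so the
        factorization fixes \<open>D'\<close> everywhere.\<close>
      then have "\<exists>q. m i q = u i" if "i \<in> {1..d}" for i
        using quant[OF that, of "u i"] that by (auto simp: cube_def PiE_iff)
      then obtain q where q: "\<And>i. i \<in> {1..d} \<Longrightarrow> m i (q i) = u i" by metis
      define x where "x = restrict q {1..d}"
      have x: "x \<in> ext_space d" by (simp add: x_def ext_space_def)
      have "\<Phi> x = u"
        using q u by (auto simp: \<Phi> x_def cube_def PiE_iff extensional_def fun_eq_iff)
      moreover have "D' (\<Phi> x) = order_df d C x" using D' x unfolding \<Phi>_def by auto
      ultimately show "D' u = D u" using D_\<Phi>[of x] by simp
    qed
  qed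
  then show "copula d (order_transform d C)"
    "is_copula_measure d (order_transform d C) (distr Q (cube_borel d) (\<lambda>u. \<Phi> (order_stat d u)))"
    "\<And>x. x \<in> ext_space d \<Longrightarrow> order_transform d C (\<Phi> x) = order_df d C x"
    using D D_\<Phi> by (simp_all add: R_def)
qed

subsection \<open>Comparison of Kendall's tau\<close>

text \<open>Change of variables along \<open>\<Phi>\<close> after \<open>order_stat\<close>; the
  factorization then removes \<open>\<Phi>\<close>, leaving an integral against the same
  \<open>Q\<close> as for \<open>C\<close>. Measurability comes from the same composition.\<close>

lemma bracket_order_transform:
  assumes C: "copula d C" and Q: "is_copula_measure d C Q"
  shows "copula_bracket d (order_transform d C) (order_transform d C) =
    (\<integral>u. order_df d C (order_stat d u) \<partial>Q)"
    and "(\<lambda>u. order_df d C (order_stat d u)) \<in> borel_measurable Q"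
proof -
  let ?\<Phi> = "\<lambda>x. \<lambda>i\<in>{1..d}. marginal_df d (order_df d C) i (x i)"
  note T = order_transform_props[OF C Q]
  note T_meas = copula_measurable[OF T(2)]
  have eq: "order_transform d C (?\<Phi> (order_stat d u)) = order_df d C (order_stat d u)" for u
    by (rule T(3)[OF order_stat_in_ext_space])
  show "copula_bracket d (order_transform d C) (order_transform d C) =
      (\<integral>u. order_df d C (order_stat d u) \<partial>Q)"
    unfolding copula_bracket_def copula_measure_eqI[OF T(2)] integral_distr[OF T(4) T_meas] eq ..
  show "(\<lambda>u. order_df d C (order_stat d u)) \<in> borel_measurable Q"
    using measurable_compose[OF T(4) T_meas] unfolding eq .
qed

lemma copula_bounds:
  assumes "copula d C" "u \<in> cube d"
  shows "0 \<le> C u" "C u \<le> 1"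
  using assms unfolding copula_def PiE_iff by auto

lemma copula_integrable:
  assumes C: "copula d C" and Q: "is_copula_measure d C Q"
  shows "integrable Q C"
proof -
  interpret prob_space Q by (rule is_copula_measure_prob[OF Q])
  have "C \<in> borel_measurable Q"
    using copula_measurable[OF Q] is_copula_measure_sets[OF Q] by (simp cong: measurable_cong_sets)
  moreover have "norm (C u) \<le> 1" if "u \<in> space Q" for u
    using copula_bounds[OF C, of u] that by (simp add: is_copula_measure_space[OF Q])
  ultimately show ?thesis by (intro integrable_const_bound[where B = 1]) auto
qed

lemma order_df_integrable:
  assumes C: "copula d C" and Q: "is_copula_measure d C Q"
  shows "integrable Q (\<lambda>u. order_df d C (order_stat d u))"
proof -
  interpret prob_space Q by (rule is_copula_measure_prob[OF Q])
  show ?thesis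
    using bracket_order_transform(2)[OF C Q]
    by (intro integrable_const_bound[where B = 1]) (auto simp: order_df_eq[OF C Q])
qed

lemma order_stat_sets:
  assumes Q: "is_copula_measure d C Q"
  shows "{u \<in> cube d. \<forall>i\<in>{1..d}. order_stat d u i \<le> x i} \<in> sets Q"
  unfolding is_copula_measure_space[OF Q, symmetric]
proof (rule sets.sets_Collect_finite_All)
  fix i assume i: "i \<in> {1..d}"
  have "(\<lambda>u. order_stat d u i) \<in> borel_measurable Q"
    using order_stat_component_measurable[OF i] is_copula_measure_sets[OF Q]
    by (simp cong: measurable_cong_sets)
  then show "{u \<in> space Q. order_stat d u i \<le> x i} \<in> sets Q" by measurable
qed simp

lemma copula_le_order_df:
  assumes C: "copula d C" and Q: "is_copula_measure d C Q" and u: "u \<in> cube d"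
  shows "C u \<le> order_df d C (order_stat d u)"
proof -
  interpret prob_space Q by (rule is_copula_measure_prob[OF Q])
  have "order_stat d x k \<le> order_stat d u k" if "\<forall>i\<in>{1..d}. x i \<le> u i" "k \<in> {1..d}" for x k
    unfolding order_stat_def using that by (intro order_map_mono) (auto simp: embed_def)
  then have "{x \<in> cube d. \<forall>i\<in>{1..d}. x i \<le> u i} \<subseteq>
      {x \<in> cube d. \<forall>i\<in>{1..d}. order_stat d x i \<le> order_stat d u i}"
    by blast
  from finite_measure_mono[OF this order_stat_sets[OF Q]] show ?thesis
    unfolding is_copula_measure_lower[OF Q u] order_df_eq[OF C Q] .
qed

text \<open>A union bound over the \<open>fact d\<close> permuted orthants below \<open>u\<close>;
  symmetry gives each of them the mass \<open>C u\<close>.\<close>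

lemma order_df_le_symmetric_copula:
  assumes sym: "symmetric_copula d C" and Q: "is_copula_measure d C Q" and u: "u \<in> cube d"
  shows "order_df d C (order_stat d u) \<le> fact d * C u"
proof -
  interpret prob_space Q by (rule is_copula_measure_prob[OF Q])
  have C: "copula d C" using sym by (simp add: symmetric_copula_def)
  let ?S = "{\<sigma>. \<sigma> permutes {1..d}}"
  let ?u = "\<lambda>\<sigma>. \<lambda>i\<in>{1..d}. u (\<sigma> i)"
  let ?B = "\<lambda>\<sigma>. {x \<in> cube d. \<forall>i\<in>{1..d}. x i \<le> ?u \<sigma> i}"
  have u\<sigma>: "?u \<sigma> \<in> cube d" if "\<sigma> permutes {1..d}" for \<sigma>
    using u permutes_in_image[OF that] unfolding cube_def by (auto simp: PiE_iff simp del: One_nat_def)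
  have B: "?B \<sigma> \<in> sets Q" for \<sigma>
    unfolding is_copula_measure_sets[OF Q] by (rule lower_orthant_sets)
  have "{x \<in> cube d. \<forall>i\<in>{1..d}. order_stat d x i \<le> order_stat d u i} \<subseteq> (\<Union>\<sigma>\<in>?S. ?B \<sigma>)"
  proof
    fix x assume x: "x \<in> {x \<in> cube d. \<forall>i\<in>{1..d}. order_stat d x i \<le> order_stat d u i}"
    then have le: "order_map d (embed d x) i \<le> order_map d (embed d u) i" if "i \<in> {1..d}" for i
      using that by (simp add: order_stat_def)
    obtain \<sigma> where \<sigma>: "\<sigma> permutes {1..d}"
      "\<And>i. i \<in> {1..d} \<Longrightarrow> embed d x i \<le> embed d u (\<sigma> i)"
      using order_map_le_imp_permuted_le[OF le] by blast
    have "x i \<le> ?u \<sigma> i" if "i \<in> {1..d}" for i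
      using \<sigma>(2)[OF that] that permutes_in_image[OF \<sigma>(1), of i] by (simp add: embed_def)
    then show "x \<in> (\<Union>\<sigma>\<in>?S. ?B \<sigma>)" using x \<sigma>(1) by blast
  qed
  then have "order_df d C (order_stat d u) \<le> measure Q (\<Union>\<sigma>\<in>?S. ?B \<sigma>)"
    unfolding order_df_eq[OF C Q] using B
    by (intro finite_measure_mono sets.finite_UN finite_permutations) auto
  also have "\<dots> \<le> (\<Sum>\<sigma>\<in>?S. measure Q (?B \<sigma>))"
    using B by (intro measure_UNION_le finite_permutations) auto
  also have "\<dots> = (\<Sum>\<sigma>\<in>?S. C u)"
  proof (intro sum.cong refl)
    fix \<sigma> assume "\<sigma> \<in> ?S"
    then have \<sigma>: "\<sigma> permutes {1..d}" by simp
    have "measure Q (?B \<sigma>) = C (?u \<sigma>)" by (rule is_copula_measure_lower[OF Q u\<sigma>[OF \<sigma>]])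
    also have "\<dots> = C u" using sym u \<sigma> unfolding symmetric_copula_def by blast
    finally show "measure Q (?B \<sigma>) = C u" .
  qed
  also have "\<dots> = fact d * C u" using card_permutations[of "{1..d}" d] by simp
  finally show ?thesis .
qed

section \<open>The minimum of the bracket and the final comparison\<close>

lemma bracket_nonneg:
  assumes C: "copula d C" and d: "0 < d"
  shows "0 \<le> copula_bracket d C C"
  unfolding copula_bracket_def
  using copula_bounds(1)[OF C] is_copula_measure_space[OF is_copula_measure[OF C d]]
  by (intro Bochner_Integration.integral_nonneg) auto

text \<open>The law of \<open>(W, 1 - W, W, \<dots>, W)\<close> with \<open>W\<close> uniform: two independent copies are almost surely incomparable.\<close>

lemma bracket_zero_attained:
  assumes d: "2 \<le> d"
  obtains D where "copula d D" "copula_bracket d D D = 0"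
proof -
  define M :: "real measure" where "M = restrict_space lborel {0..1}"
  interpret prob_space M
    by (rule prob_spaceI) (simp add: M_def space_restrict_space emeasure_restrict_space)
  have spM: "space M = {0..1}" by (simp add: M_def space_restrict_space)
  have M_eq: "measure M A = measure lborel A" if "A \<subseteq> {0..1}" for A
    unfolding M_def using that by (intro measure_restrict_space) auto
  define f :: "real \<Rightarrow> nat \<Rightarrow> real" where "f w = (\<lambda>i\<in>{1..d}. if i = 2 then 1 - w else w)" for w
  have f_cube: "f w \<in> cube d" if "w \<in> {0..1}" for w using that by (auto simp: f_def cube_def)
  have f_meas: "f \<in> measurable M (cube_borel d)"
    unfolding f_def[abs_def] cube_borel_def
  proof (rule measurable_restrict)
    fix i
    have "(\<lambda>w. if i = 2 then 1 - w else w) \<in> borel_measurable M"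
      unfolding M_def by (intro measurable_restrict_space1) auto
    then show "(\<lambda>w. if i = 2 then 1 - w else w) \<in> measurable M (restrict_space borel {0..1})"
      by (intro measurable_restrict_space2) (auto simp: spM)
  qed
  define Q where "Q = distr M (cube_borel d) f"
  have Q: "prob_space Q" "sets Q = sets (cube_borel d)"
    unfolding Q_def using prob_space_distr[OF f_meas] by auto
  have marg: "measure Q {x \<in> cube d. x i \<le> t} = t" if i: "i \<in> {1..d}" and t: "0 \<le> t" "t \<le> 1" for i t
  proof -
    have "{x \<in> cube d. x i \<le> t} \<in> sets (cube_borel d)"
      using measurable_cube_component[OF i] unfolding space_cube_borel[symmetric] by measurable
    then have "measure Q {x \<in> cube d. x i \<le> t} = measure M (f -` {x \<in> cube d. x i \<le> t} \<inter> space M)"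
      unfolding Q_def by (rule measure_distr[OF f_meas])
    also have "f -` {x \<in> cube d. x i \<le> t} \<inter> space M = (if i = 2 then {1 - t..1} else {0..t})"
      using f_cube i t by (auto simp: spM f_def)
    also have "measure M \<dots> = t" using t by (subst M_eq) auto
    finally show ?thesis .
  qed
  define D where "D = (\<lambda>u\<in>cube d. measure Q (PiE {1..d} (\<lambda>i. {0..u i})))"
  have D: "copula d D" "is_copula_measure d D Q"
    unfolding D_def by (rule copula_of_measure[OF Q marg]; assumption)+
  have D_f: "D (f w) = 0" if w: "w \<in> space M" for w
  proof -
    have fw: "f w \<in> cube d" using f_cube w spM by simp
    note box = lower_orthant_sets[of d "f w"]
    have "D (f w) = measure M (f -` {x \<in> cube d. \<forall>i\<in>{1..d}. x i \<le> f w i} \<inter> space M)"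
      unfolding is_copula_measure_lower[OF D(2) fw, symmetric] Q_def by (rule measure_distr[OF f_meas box])
    \<comment> \<open>Coordinates 1 and 2, both present as \<open>d >= 2\<close>, require
      \<open>w' <= w\<close> and \<open>1 - w' <= 1 - w\<close>.\<close>
    also have "f -` {x \<in> cube d. \<forall>i\<in>{1..d}. x i \<le> f w i} \<inter> space M = {w}"
    proof (intro set_eqI iffI)
      fix w' assume "w' \<in> f -` {x \<in> cube d. \<forall>i\<in>{1..d}. x i \<le> f w i} \<inter> space M"
      then have le: "\<And>i. i \<in> {1..d} \<Longrightarrow> f w' i \<le> f w i" by auto
      show "w' \<in> {w}" using le[of 1] le[of 2] d by (simp add: f_def)
    qed (use fw w in auto)
    also have "measure M {w} = 0" using w spM by (subst M_eq) auto
    finally show ?thesis .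
  qed
  have "copula_bracket d D D = (\<integral>w. D (f w) \<partial>M)"
    unfolding copula_bracket_def copula_measure_eqI[OF D(2)] unfolding Q_def
    by (rule integral_distr[OF f_meas copula_measurable[OF D(2)]])
  also have "\<dots> = (\<integral>w. 0 \<partial>M)" using D_f by (intro Bochner_Integration.integral_cong) auto
  finally show ?thesis using that[OF D(1)] by simp
qed

lemma kendall_tau_le_iff:
  assumes "2 \<le> d"
  shows "kendall_tau d C \<le> kendall_tau d D \<longleftrightarrow> copula_bracket d C C \<le> copula_bracket d D D"
proof -
  have "(1::real) < 2 ^ (d - 1)" using assms by (intro one_less_power) auto
  then show ?thesis by (simp add: kendall_tau_def divide_le_cancel)
qed

theorem theorem5p4:
  fixes d :: nat and C :: "(nat \<Rightarrow> real) \<Rightarrow> real"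
  assumes "d \<ge> 2" and "copula d C"
  shows "kendall_tau d C \<le> kendall_tau d (order_transform d C) \<and>
    (minimizes_kendall_tau d (order_transform d C) \<longrightarrow> minimizes_kendall_tau d C) \<and>
    (symmetric_copula d C \<and> minimizes_kendall_tau d C \<longrightarrow>
       minimizes_kendall_tau d (order_transform d C))"
proof -
  note tau = kendall_tau_le_iff[OF assms(1)]
  define Q where "Q = copula_measure d C"
  have d: "0 < d" using assms(1) by simp
  have Q: "is_copula_measure d C Q" unfolding Q_def by (rule is_copula_measure[OF assms(2) d])
  note sp = is_copula_measure_space[OF Q]
  note bracket_T = bracket_order_transform(1)[OF assms(2) Q]
  have T: "copula d (order_transform d C)" by (rule order_transform_props(1)[OF assms(2) Q])
  have bracket_C: "copula_bracket d C C = (\<integral>u. C u \<partial>Q)" by (simp add: copula_bracket_def Q_def)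
  have le: "copula_bracket d C C \<le> copula_bracket d (order_transform d C) (order_transform d C)"
    unfolding bracket_C bracket_T
    using copula_le_order_df[OF assms(2) Q]
    by (intro integral_mono copula_integrable[OF assms(2) Q] order_df_integrable[OF assms(2) Q])
       (simp add: sp)
  moreover have "minimizes_kendall_tau d C" if "minimizes_kendall_tau d (order_transform d C)"
    using that assms(2) le unfolding minimizes_kendall_tau_def tau by (meson order_trans)
  moreover have "minimizes_kendall_tau d (order_transform d C)"
    if sym: "symmetric_copula d C" and min: "minimizes_kendall_tau d C"
  proof -
    obtain D where "copula d D" "copula_bracket d D D = 0"
      using bracket_zero_attained[OF assms(1)] .
    \<comment> \<open>Minimality is relative to all copulas, so comparison with the explicit
      \<open>D\<close> turns it into a vanishing bracket, and multiplying by \<open>fact d\<close>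
      then costs nothing.\<close>
    then have zero: "copula_bracket d C C \<le> 0"
      using min unfolding minimizes_kendall_tau_def tau by metis
    have "copula_bracket d (order_transform d C) (order_transform d C) \<le> (\<integral>u. fact d * C u \<partial>Q)"
      unfolding bracket_T using order_df_le_symmetric_copula[OF sym Q]
      by (intro integral_mono order_df_integrable[OF assms(2) Q] integrable_mult_right
          copula_integrable[OF assms(2) Q]) (simp add: sp)
    also have "\<dots> = fact d * copula_bracket d C C" by (simp add: bracket_C)
    also have "\<dots> \<le> 0" using zero by (simp add: mult_le_0_iff)
    finally show ?thesis
      using T bracket_nonneg[OF _ d] unfolding minimizes_kendall_tau_def tau by (meson order_trans)
  qed
  ultimately show ?thesis unfolding tau by blast
qed

end
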